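(* Let $\Omega_2\subset\{0,1,2\}^{\mathbb N}$ be the set of sequences in which at least two of the symbols $0,1,2$ occur infinitely many times. For every $\omega\in\Omega_2$, the spectrum of the group $G_\omega$ with respect to the generating set $S_\omega=\{a,b_\omega,c_\omega,d_\omega\}$ is $$\mathrm{sp}(G_\omega)=[-\tfrac12,0]\cup[\tfrac12,1].$$
   Context: Spectrum of a group. For a group $G$ with a finite symmetric generating set $S=S^{-1}$, the Markov operator on $l^2(G)$ is $(Mf)(g)=\frac1{|S|}\sum_{s\in S}f(s^{-1}g)$, and $\mathrm{sp}(G)$ denotes the spectrum of $M$ (with respect to the specified $S$). The groups $G_\omega$. Let $T$ be the binary rooted tree whose vertices are the finite words over $\{0,1\}$ (the root is the empty word), where two words are joined by an edge iff one is obtained from the other by appending one letter at the end. Put $w_0=\varnothing$ (the empty word) and $w_n=1^{n-1}0$ for $n\ge1$. Let $\sigma_n$ be the automorphism of $T$ given by $\sigma_n(w_n0v)=w_n1v$, $\sigma_n(w_n1v)=w_n0v$ for every finite word $v$, and $\sigma_n(u)=u$ for all other vertices $u$. Associate to the symbols the columns in the alphabet $\{\Pi,\mathrm I\}$: $\overline 0=(\Pi,\Pi,\mathrm I)^{T}$, $\overline 1=(\Pi,\mathrm I,\Pi)^{T}$, $\overline 2=(\mathrm I,\Pi,\Pi)^{T}$. For $\omega=\omega_1\omega_2\cdots\in\{0,1,2\}^{\mathbb N}$ let $\beta_1<\beta_2<\cdots$ (respectively $\gamma_1<\gamma_2<\cdots$, $\delta_1<\delta_2<\cdots$) be the indices $n\geq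 1$ for which the first (respectively second, third) entry of $\overline{\omega_n}$ is $\Pi$. Define automorphisms of $T$ by $a=\sigma_0$, $b_\omega=\prod_i\sigma_{\beta_i}$, $c_\omega=\prod_i\sigma_{\gamma_i}$, $d_\omega=\prod_i\sigma_{\delta_i}$ (the factors in each product commute). $G_\omega$ is the group of automorphisms of $T$ generated by $a,b_\omega,c_\omega,d_\omega$. One has $a^2=b_\omega^2=c_\omega^2=d_\omega^2=b_\omega c_\omega d_\omega=1$. *)

theory Defs
  imports "HOL-Analysis.Analysis" "HOL-Algebra.Elementary_Groups"
begin

section \<open>Square-summable functions and the spectrum of an operator\<close>

text \<open>The Hilbert space of a set \<open>X\<close> is represented by the complex functions on the ambient
  type that vanish outside \<open>X\<close>.\<close>

definition ell2 :: "'a set \<Rightarrow> ('a \<Rightarrow> complex) set" where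
  "ell2 X = {f. (\<forall>x. x \<notin> X \<longrightarrow> f x = 0) \<and> (\<lambda>x. (cmod (f x))\<^sup>2) summable_on X}"

definition ell2_norm :: "'a set \<Rightarrow> ('a \<Rightarrow> complex) \<Rightarrow> real" where
  "ell2_norm X f = sqrt (\<Sum>\<^sub>\<infinity>x\<in>X. (cmod (f x))\<^sup>2)"

definition bounded_operator :: "'a set \<Rightarrow> (('a \<Rightarrow> complex) \<Rightarrow> 'a \<Rightarrow> complex) \<Rightarrow> bool" where
  "bounded_operator X A \<longleftrightarrow>
     (\<forall>f\<in>ell2 X. A f \<in> ell2 X) \<and>
     (\<forall>f\<in>ell2 X. \<forall>g\<in>ell2 X. A (\<lambda>x. f x + g x) = (\<lambda>x. A f x + A g x)) \<and>
     (\<forall>c. \<forall>f\<in>ell2 X. A (\<lambda>x. c * f x) = (\<lambda>x. c * A f x)) \<and>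
     (\<exists>K. \<forall>f\<in>ell2 X. ell2_norm X (A f) \<le> K * ell2_norm X f)"

definition spectrum :: "'a set \<Rightarrow> (('a \<Rightarrow> complex) \<Rightarrow> 'a \<Rightarrow> complex) \<Rightarrow> complex set" where
  "spectrum X A = {l. \<not> (\<exists>B. bounded_operator X B \<and>
     (\<forall>f\<in>ell2 X. B (\<lambda>x. A f x - l * f x) = f \<and> (\<lambda>x. A (B f) x - l * B f x) = f))}"

definition markov :: "('g, 'm) monoid_scheme \<Rightarrow> 'g set \<Rightarrow> ('g \<Rightarrow> complex) \<Rightarrow> 'g \<Rightarrow> complex" where
  "markov G S f = (\<lambda>g. if g \<in> carrier G
     then (1 / of_nat (card S)) * (\<Sum>s\<in>S. f (inv\<^bsub>G\<^esub> s \<otimes>\<^bsub>G\<^esub> g)) else 0)"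

definition group_spectrum :: "('g, 'm) monoid_scheme \<Rightarrow> 'g set \<Rightarrow> complex set" where
  "group_spectrum G S = spectrum (carrier G) (markov G S)"


section \<open>The binary rooted tree and its automorphism group\<close>

text \<open>Vertices are finite words over \<open>{0, 1}\<close>, with \<open>0\<close> encoded as \<open>False\<close> and \<open>1\<close> as \<open>True\<close>.\<close>

type_synonym vertex = "bool list"

definition adjacent :: "vertex \<Rightarrow> vertex \<Rightarrow> bool" where
  "adjacent u v \<longleftrightarrow> (\<exists>x. v = u @ [x]) \<or> (\<exists>x. u = v @ [x])"

definition tree_aut :: "(vertex \<Rightarrow> vertex) set" where
  "tree_aut = {f. bij f \<and> f [] = [] \<and> (\<forall>u v. adjacent (f u) (f v) \<longleftrightarrow> adjacent u v)}"

definition tree_aut_group :: "(vertex \<Rightarrow> vertex) monoid" where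
  "tree_aut_group = \<lparr>carrier = tree_aut, monoid.mult = (\<circ>), one = id\<rparr>"

definition word :: "nat \<Rightarrow> vertex" where
  "word n = (if n = 0 then [] else replicate (n - 1) True @ [False])"

definition sigma_aut :: "nat \<Rightarrow> vertex \<Rightarrow> vertex" where
  "sigma_aut n u = (if \<exists>x v. u = word n @ x # v then u[n := \<not> u ! n] else u)"

lemma length_word [simp]: "length (word n) = n"
  by (simp add: word_def)

lemma sigma_word [simp]:
  "sigma_aut n (word n @ False # v) = word n @ True # v"
  "sigma_aut n (word n @ True # v) = word n @ False # v"
  using list_update_length[of "word n"] nth_append_length[of "word n"]
  by (auto simp: sigma_aut_def)

lemma sigma_other: "(\<And>x v. u \<noteq> word n @ x # v) \<Longrightarrow> sigma_aut n u = u"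
  by (simp add: sigma_aut_def)

text \<open>The product of all \<open>\<sigma>\<^sub>n\<close> with \<open>n \<in> B\<close> is the pointwise limit of its finite partial products:
  on each vertex these are eventually constant.\<close>

primrec partial_sigma_prod :: "nat set \<Rightarrow> nat \<Rightarrow> vertex \<Rightarrow> vertex" where
  "partial_sigma_prod B 0 = id"
| "partial_sigma_prod B (Suc n) =
     partial_sigma_prod B n \<circ> (if n \<in> B then sigma_aut n else id)"

definition sigma_prod :: "nat set \<Rightarrow> vertex \<Rightarrow> vertex" where
  "sigma_prod B u = (THE v. \<forall>\<^sub>F N in sequentially. partial_sigma_prod B N u = v)"

lemma sigma_short: "length u \<le> n \<Longrightarrow> sigma_aut n u = u"
  by (rule sigma_other) auto

lemma partial_sigma_prod_stable:
  "length u \<le> N \<Longrightarrow> partial_sigma_prod B N u = partial_sigma_prod B (length u) u"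
  by (induction N rule: dec_induct) (simp_all add: sigma_short)

lemma sigma_prod_eq: "sigma_prod B u = partial_sigma_prod B (length u) u"
  unfolding sigma_prod_def
proof (rule the_equality)
  show ev: "\<forall>\<^sub>F N in sequentially. partial_sigma_prod B N u = partial_sigma_prod B (length u) u"
    unfolding eventually_sequentially using partial_sigma_prod_stable by blast
  fix v assume "\<forall>\<^sub>F N in sequentially. partial_sigma_prod B N u = v"
  with ev have "\<forall>\<^sub>F N in sequentially. v = partial_sigma_prod B (length u) u"
    by eventually_elim simp
  then show "v = partial_sigma_prod B (length u) u" by simp
qed


subsection \<open>These maps are tree automorphisms\<close>

lemma length_sigma [simp]: "length (sigma_aut n u) = length u"
  by (simp add: sigma_aut_def)

lemma sigma_sigma [simp]: "sigma_aut n (sigma_aut n u) = u"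
proof (cases "\<exists>x v. u = word n @ x # v")
  case True
  then obtain x v where "u = word n @ x # v" by blast
  then show ?thesis by (cases x) simp_all
qed (simp add: sigma_other)

lemma sigma_snoc: "\<exists>y. sigma_aut n (u @ [x]) = sigma_aut n u @ [y]"
proof (cases "\<exists>z v. u = word n @ z # v")
  case True
  then obtain z v where u: "u = word n @ z # v" by blast
  show ?thesis
    using sigma_word[of n "v @ [x]"] by (cases z) (simp_all add: u)
next
  case False
  show ?thesis
  proof (cases "u = word n")
    case True
    then show ?thesis
      using sigma_word[of n "[]"] by (cases x) (simp_all add: sigma_short exI[of _ False] exI[of _ True])
  next
    case False': False
    have "u @ [x] \<noteq> word n @ z # v" for z v
      using False False' by (cases v rule: rev_cases) auto
    then show ?thesis using False by (simp add: sigma_other)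
  qed
qed

lemma tree_autI:
  assumes "bij f" and len: "\<And>u. length (f u) = length u"
    and snoc: "\<And>u x. \<exists>y. f (u @ [x]) = f u @ [y]"
  shows "f \<in> tree_aut"
proof -
  have inj: "f u = f v \<longleftrightarrow> u = v" for u v
    using \<open>bij f\<close> by (auto dest: bij_is_inj injD)
  have "(\<exists>x. f v = f u @ [x]) \<longleftrightarrow> (\<exists>x. v = u @ [x])" for u v
  proof
    assume "\<exists>x. f v = f u @ [x]"
    then obtain x where x: "f v = f u @ [x]" ..
    then have "length v = Suc (length u)" using len by (metis length_append_singleton)
    then obtain v' z where v: "v = v' @ [z]" by (cases v rule: rev_cases) auto
    then have "f v' = f u" using snoc[of v' z] x by auto
    then show "\<exists>x. v = u @ [x]" using v inj by blast
  qed (use snoc in blast)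
  then show ?thesis
    using \<open>bij f\<close> len[of "[]"] by (simp add: tree_aut_def adjacent_def)
qed

lemma sigma_in_tree_aut: "sigma_aut n \<in> tree_aut"
  by (rule tree_autI) (auto intro: involuntory_imp_bij sigma_snoc)

lemma length_partial_sigma_prod [simp]: "length (partial_sigma_prod B N u) = length u"
  by (induction N arbitrary: u) simp_all

lemma partial_sigma_prod_snoc:
  "\<exists>y. partial_sigma_prod B N (u @ [x]) = partial_sigma_prod B N u @ [y]"
proof (induction N arbitrary: u x)
  case (Suc N)
  then show ?case using sigma_snoc[of N u x] by auto
qed simp

lemma bij_partial_sigma_prod: "bij (partial_sigma_prod B N)"
proof (induction N)
  case (Suc N)
  have "bij (sigma_aut N)" by (rule involuntory_imp_bij) simp
  with Suc show ?case by (simp add: bij_comp[unfolded comp_def])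
qed (simp add: bij_def)

lemma sigma_prod_in_tree_aut: "sigma_prod B \<in> tree_aut"
proof (rule tree_autI)
  show len: "length (sigma_prod B u) = length u" for u
    by (simp add: sigma_prod_eq)
  show "bij (sigma_prod B)"
  proof (rule bijI)
    show "inj (sigma_prod B)"
    proof (rule injI)
      fix u v assume eq: "sigma_prod B u = sigma_prod B v"
      then have "length u = length v" using len by metis
      then show "u = v"
        using eq bij_partial_sigma_prod[of B "length u"]
        by (simp add: sigma_prod_eq bij_def inj_def)
    qed
    show "surj (sigma_prod B)"
      unfolding surj_def
    proof
      fix v
      obtain u where "v = partial_sigma_prod B (length v) u"
        using bij_partial_sigma_prod[of B "length v"] by (metis bij_pointE)
      then show "\<exists>u. v = sigma_prod B u"
        by (metis length_partial_sigma_prod sigma_prod_eq)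
    qed
  qed
  show "\<exists>y. sigma_prod B (u @ [x]) = sigma_prod B u @ [y]" for u x
    using partial_sigma_prod_snoc[of B "Suc (length u)" u x]
      partial_sigma_prod_stable[of u "Suc (length u)" B]
    by (simp only: sigma_prod_eq length_append_singleton)
qed

lemma group_tree_aut_group: "group tree_aut_group"
proof (rule groupI)
  fix f assume f: "f \<in> carrier tree_aut_group"
  then have bij: "bij f" and root: "f [] = []"
    and adj: "\<And>u v. adjacent (f u) (f v) \<longleftrightarrow> adjacent u v"
    by (auto simp: tree_aut_group_def tree_aut_def)
  have "inv_into UNIV f \<in> tree_aut"
    using bij_imp_bij_inv[OF bij] bij_inv_eq_iff[OF bij, of "[]" "[]"] root
      adj[of "inv_into UNIV f u" "inv_into UNIV f v" for u v] bij_is_surj[OF bij]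
    by (auto simp: tree_aut_def surj_f_inv_f)
  moreover have "inv_into UNIV f \<circ> f = id"
    using bij by (simp add: bij_is_inj)
  ultimately show "\<exists>g\<in>carrier tree_aut_group. g \<otimes>\<^bsub>tree_aut_group\<^esub> f = \<one>\<^bsub>tree_aut_group\<^esub>"
    by (auto simp: tree_aut_group_def)
qed (auto simp: tree_aut_group_def tree_aut_def bij_comp o_assoc)


section \<open>The groups \<open>G\<^sub>\<omega>\<close>\<close>

datatype entry = PiSym | ISym

definition column :: "nat \<Rightarrow> entry \<times> entry \<times> entry" where
  "column k = (if k = 0 then (PiSym, PiSym, ISym) else if k = 1 then (PiSym, ISym, PiSym) else (ISym, PiSym, PiSym))"

text \<open>A sequence \<open>\<omega>\<^sub>1\<omega>\<^sub>2\<dots>\<close> over \<open>{0, 1, 2}\<close> is a function on the indices \<open>n \<ge> 1\<close>.\<close>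

definition Omega :: "(nat \<Rightarrow> nat) set" where
  "Omega = {1..} \<rightarrow>\<^sub>E {0, 1, 2}"

definition Omega2 :: "(nat \<Rightarrow> nat) set" where
  "Omega2 = {\<omega> \<in> Omega. card {k \<in> {0, 1, 2}. infinite {n. n \<ge> 1 \<and> \<omega> n = k}} \<ge> 2}"

definition gen_a :: "vertex \<Rightarrow> vertex" where
  "gen_a = sigma_aut 0"

definition gen_b :: "(nat \<Rightarrow> nat) \<Rightarrow> vertex \<Rightarrow> vertex" where
  "gen_b \<omega> = sigma_prod {n. n \<ge> 1 \<and> fst (column (\<omega> n)) = PiSym}"

definition gen_c :: "(nat \<Rightarrow> nat) \<Rightarrow> vertex \<Rightarrow> vertex" where
  "gen_c \<omega> = sigma_prod {n. n \<ge> 1 \<and> fst (snd (column (\<omega> n))) = PiSym}"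

definition gen_d :: "(nat \<Rightarrow> nat) \<Rightarrow> vertex \<Rightarrow> vertex" where
  "gen_d \<omega> = sigma_prod {n. n \<ge> 1 \<and> snd (snd (column (\<omega> n))) = PiSym}"

definition gens :: "(nat \<Rightarrow> nat) \<Rightarrow> (vertex \<Rightarrow> vertex) set" where
  "gens \<omega> = {gen_a, gen_b \<omega>, gen_c \<omega>, gen_d \<omega>}"

definition G_omega :: "(nat \<Rightarrow> nat) \<Rightarrow> (vertex \<Rightarrow> vertex) monoid" where
  "G_omega \<omega> = subgroup_generated tree_aut_group (gens \<omega>)"

text \<open>\<^const>\<open>subgroup_generated\<close> discards generators outside the ambient carrier; there are none.\<close>

lemma gens_subset_carrier: "gens \<omega> \<subseteq> carrier tree_aut_group"
  by (auto simp: gens_def gen_a_def gen_b_def gen_c_def gen_d_def tree_aut_group_def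
      sigma_in_tree_aut sigma_prod_in_tree_aut)

end

theory Submission
  imports Defs
begin

text \<open>Let \<open>M\<close> be the Markov operator, \<open>A\<close> the translation by \<open>a\<close> and \<open>V = (b + c + d - 1) / 2\<close>, so that
  \<open>4M = 1 + A + 2V\<close>.  As \<open>{1, b, c, d}\<close> is a four-group, \<open>V = 2P - 1\<close> for the projection \<open>P\<close> onto its
  invariant functions.  Thus \<open>A\<close> and \<open>V\<close> are unitary involutions, and \<open>(A + 2V)\<^sup>2 = 5 + 2(AV + VA)\<close>,
  where \<open>AV + VA\<close> is the sum of a unitary operator and its inverse and has spectrum in \<open>[-2, 2]\<close>.  Hence the
  spectrum of \<open>4M - 1\<close> lies in \<open>[-3, -1] \<union> [1, 3]\<close>.  This is one inclusion, and it holds for every group with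
  such generators (\<open>group_spectrum_subset\<close>).

  For the other inclusion every point of \<open>[-1/2, 0] \<union> [1/2, 1]\<close> has to be an approximate eigenvalue.
  The words of length \<open>n\<close> form a path of \<open>2\<^sup>n\<close> points on which \<open>a\<close> exchanges neighbours, while two of \<open>b, c, d\<close>
  exchange the neighbours that \<open>a\<close> does not exchange and the third fixes them.  So \<open>V\<close> acts on functions on
  the path as a permutation of the points, and \<open>A + 2V\<close> has explicit
  eigenfunctions with the eigenvalues \<open>\<plusminus> sqrt (1 + 8 cos\<^sup>2 \<theta>)\<close> for multiples \<open>\<theta>\<close> of \<open>\<pi> / 2\<^sup>n\<close>
  (\<open>path_eigenfunction\<close>).  For growing \<open>n\<close> these values are dense in \<open>[-3, -1] \<union> [1, 3]\<close>.

  Let \<open>f\<close> be such an eigenfunction and \<open>x\<close> a word of length \<open>n\<close>.  The function that sends \<open>g\<close> to \<open>f\<close> at the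
  position of \<open>g x\<close> satisfies the eigenvalue equation on the group, but it is not square-summable.
  It is made so by an almost invariant, finitely supported weight; that there is one is the amenability of
  the group.  The weight is explicit.  The generators have nontrivial sections at level \<open>n\<close>
  only at the two ends of the path: elements of a four-group at one end, and powers of \<open>a\<close> at the other.
  The weight of a map \<open>h\<close> is a product over the words \<open>u\<close> of length \<open>n\<close> of an amplitude that depends on
  the section of \<open>h\<close> at \<open>u\<close> and on the position of \<open>h u\<close>.  As a function of the section, the amplitude at
  one end of the path is uniform on the products of the four-group with \<open>{1, a}\<close>, so that it does not see the
  four-group; at the other end it is concentrated on \<open>{1, a}\<close>, so that it does not see \<open>a\<close>.  In between, this
  unit vector turns by the angle \<open>\<pi>/3\<close> in \<open>2\<^sup>n - 1\<close> equal steps.  A generator moves each word by at most one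
  step, so the weight changes in squared norm by at most about \<open>2\<^sup>n\<close> times the square of \<open>\<pi> / (3 \<cdot> 2\<^sup>n)\<close>
  (\<open>weight_energy\<close>), which tends to \<open>0\<close>.

  The weight is a vector on a set of surjective maps of the tree that is larger than the group.  The group acts on
  it freely by left composition, so each orbit is a copy of the group, and on at least one orbit the ratio of
  residual to norm is no larger than on the whole set (\<open>approximate_eigenvector_on_orbit\<close>).\<close>

section \<open>Square-summable functions and bounded operators\<close>

lemma ell2_zero_outside: "f \<in> ell2 X \<Longrightarrow> x \<notin> X \<Longrightarrow> f x = 0"
  by (simp add: ell2_def)

lemma ell2_norm_nonneg: "0 \<le> ell2_norm X f"
  by (simp add: ell2_norm_def infsum_nonneg)

lemma L2_set_le_ell2_norm:
  assumes "f \<in> ell2 X" "finite F" "F \<subseteq> X"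
  shows "L2_set (\<lambda>x. cmod (f x)) F \<le> ell2_norm X f"
  unfolding L2_set_def ell2_norm_def
  using assms by (intro real_sqrt_le_mono finite_sum_le_infsum) (auto simp: ell2_def)

text \<open>Bounds on finite sets, where the Minkowski inequality for finite sums is at hand, are all that is
  needed to see that a function is square-summable and to estimate its norm.\<close>

lemma ell2_finite_bound:
  assumes supp: "\<And>x. x \<notin> X \<Longrightarrow> f x = 0"
    and bd: "\<And>F. finite F \<Longrightarrow> F \<subseteq> X \<Longrightarrow> L2_set (\<lambda>x. cmod (f x)) F \<le> K"
  shows "f \<in> ell2 X" "ell2_norm X f \<le> K"
proof -
  have K: "0 \<le> K" using bd[of "{}"] by simp
  have sq: "(\<Sum>x\<in>F. (cmod (f x))\<^sup>2) \<le> K\<^sup>2" if "finite F" "F \<subseteq> X" for F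
    using bd[OF that] unfolding L2_set_def by (rule sqrt_le_D)
  have summ: "(\<lambda>x. (cmod (f x))\<^sup>2) summable_on X"
    by (rule nonneg_bdd_above_summable_on) (auto intro!: bdd_aboveI2[where M = "K\<^sup>2"] sq)
  then show "f \<in> ell2 X" using supp by (simp add: ell2_def)
  have "(\<Sum>\<^sub>\<infinity>x\<in>X. (cmod (f x))\<^sup>2) \<le> K\<^sup>2"
    by (rule infsum_le_finite_sums[OF summ]) (rule sq)
  then show "ell2_norm X f \<le> K"
    unfolding ell2_norm_def using K by (simp add: real_le_lsqrt)
qed

lemma ell2_add:
  assumes "f \<in> ell2 X" "g \<in> ell2 X"
  shows "(\<lambda>x. f x + g x) \<in> ell2 X"
    and "ell2_norm X (\<lambda>x. f x + g x) \<le> ell2_norm X f + ell2_norm X g"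
proof -
  have "L2_set (\<lambda>x. cmod (f x + g x)) F \<le> ell2_norm X f + ell2_norm X g"
    if F: "finite F" "F \<subseteq> X" for F
  proof -
    have "L2_set (\<lambda>x. cmod (f x + g x)) F \<le> L2_set (\<lambda>x. cmod (f x) + cmod (g x)) F"
      by (rule L2_set_mono) (auto intro: norm_triangle_ineq)
    also have "\<dots> \<le> L2_set (\<lambda>x. cmod (f x)) F + L2_set (\<lambda>x. cmod (g x)) F"
      by (rule L2_set_triangle_ineq)
    also have "\<dots> \<le> ell2_norm X f + ell2_norm X g"
      using assms F by (intro add_mono L2_set_le_ell2_norm)
    finally show ?thesis .
  qed
  moreover have "f x + g x = 0" if "x \<notin> X" for x
    using assms that by (simp add: ell2_zero_outside)
  ultimately show "(\<lambda>x. f x + g x) \<in> ell2 X"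
    and "ell2_norm X (\<lambda>x. f x + g x) \<le> ell2_norm X f + ell2_norm X g"
    using ell2_finite_bound[of X "\<lambda>x. f x + g x"] by blast+
qed

lemma ell2_scale:
  assumes "f \<in> ell2 X"
  shows "(\<lambda>x. c * f x) \<in> ell2 X" and "ell2_norm X (\<lambda>x. c * f x) = cmod c * ell2_norm X f"
  using assms
  by (auto simp: ell2_def ell2_norm_def norm_mult power_mult_distrib infsum_cmult_right'
      real_sqrt_mult intro: summable_on_cmult_right)

lemma cmod_le_ell2_norm: "f \<in> ell2 X \<Longrightarrow> cmod (f x) \<le> ell2_norm X f"
  using L2_set_le_ell2_norm[of f X "{x}"]
  by (cases "x \<in> X") (auto simp: ell2_norm_nonneg ell2_zero_outside)

lemma ell2_norm_eq_0: "f \<in> ell2 X \<Longrightarrow> ell2_norm X f \<le> 0 \<Longrightarrow> f = (\<lambda>_. 0)"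
proof
  fix x assume "f \<in> ell2 X" "ell2_norm X f \<le> 0"
  then have "cmod (f x) \<le> 0" using cmod_le_ell2_norm[of f X x] by linarith
  then show "f x = 0" by simp
qed

lemma ell2_0: "(\<lambda>_. 0) \<in> ell2 X"
  by (simp add: ell2_def)

lemma bounded_operatorD:
  assumes "bounded_operator X A"
  shows bounded_operator_ell2: "f \<in> ell2 X \<Longrightarrow> A f \<in> ell2 X"
    and bounded_operator_add: "f \<in> ell2 X \<Longrightarrow> g \<in> ell2 X \<Longrightarrow> A (\<lambda>x. f x + g x) = (\<lambda>x. A f x + A g x)"
    and bounded_operator_scale: "f \<in> ell2 X \<Longrightarrow> A (\<lambda>x. c * f x) = (\<lambda>x. c * A f x)"
  using assms by (auto simp: bounded_operator_def)

lemma bounded_operator_bound: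
  assumes "bounded_operator X A"
  obtains K where "K \<ge> 0" "\<And>f. f \<in> ell2 X \<Longrightarrow> ell2_norm X (A f) \<le> K * ell2_norm X f"
proof -
  from assms obtain K where K: "\<And>f. f \<in> ell2 X \<Longrightarrow> ell2_norm X (A f) \<le> K * ell2_norm X f"
    unfolding bounded_operator_def by blast
  have "ell2_norm X (A f) \<le> \<bar>K\<bar> * ell2_norm X f" if "f \<in> ell2 X" for f
    using K[OF that] mult_right_mono[OF abs_ge_self[of K] ell2_norm_nonneg[of X f]] by linarith
  then show ?thesis using that[of "\<bar>K\<bar>"] by simp
qed

lemma bounded_operatorI:
  assumes "\<And>f. f \<in> ell2 X \<Longrightarrow> A f \<in> ell2 X"
    and "\<And>f g. f \<in> ell2 X \<Longrightarrow> g \<in> ell2 X \<Longrightarrow> A (\<lambda>x. f x + g x) = (\<lambda>x. A f x + A g x)"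
    and "\<And>c f. f \<in> ell2 X \<Longrightarrow> A (\<lambda>x. c * f x) = (\<lambda>x. c * A f x)"
    and "\<And>f. f \<in> ell2 X \<Longrightarrow> ell2_norm X (A f) \<le> K * ell2_norm X f"
  shows "bounded_operator X A"
  using assms unfolding bounded_operator_def by blast

lemma bounded_operator_compose:
  assumes A: "bounded_operator X A" and B: "bounded_operator X B"
  shows "bounded_operator X (\<lambda>f. A (B f))"
proof -
  obtain K where K: "K \<ge> 0" "\<And>f. f \<in> ell2 X \<Longrightarrow> ell2_norm X (A f) \<le> K * ell2_norm X f"
    using A by (rule bounded_operator_bound) blast
  obtain L where L: "L \<ge> 0" "\<And>f. f \<in> ell2 X \<Longrightarrow> ell2_norm X (B f) \<le> L * ell2_norm X f"
    using B by (rule bounded_operator_bound) blast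
  have "ell2_norm X (A (B f)) \<le> (K * L) * ell2_norm X f" if "f \<in> ell2 X" for f
    using K(2)[OF bounded_operator_ell2[OF B that]] mult_left_mono[OF L(2)[OF that] K(1)]
    by (simp add: mult.assoc)
  then show ?thesis
    by (intro bounded_operatorI[where K = "K * L"])
      (simp_all add: bounded_operatorD[OF A] bounded_operatorD[OF B])
qed

lemma bounded_operator_plus:
  assumes A: "bounded_operator X A" and B: "bounded_operator X B"
  shows "bounded_operator X (\<lambda>f x. A f x + B f x)"
proof -
  obtain K where K: "K \<ge> 0" "\<And>f. f \<in> ell2 X \<Longrightarrow> ell2_norm X (A f) \<le> K * ell2_norm X f"
    using A by (rule bounded_operator_bound) blast
  obtain L where L: "L \<ge> 0" "\<And>f. f \<in> ell2 X \<Longrightarrow> ell2_norm X (B f) \<le> L * ell2_norm X f"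
    using B by (rule bounded_operator_bound) blast
  have "ell2_norm X (\<lambda>x. A f x + B f x) \<le> (K + L) * ell2_norm X f" if "f \<in> ell2 X" for f
    using K(2)[OF that] L(2)[OF that]
      ell2_add(2)[OF bounded_operator_ell2[OF A that] bounded_operator_ell2[OF B that]]
    by (simp add: algebra_simps)
  then show ?thesis
    by (intro bounded_operatorI[where K = "K + L"])
      (simp_all add: bounded_operatorD[OF A] bounded_operatorD[OF B] ell2_add distrib_left add_ac)
qed

lemma bounded_operator_times:
  assumes A: "bounded_operator X A"
  shows "bounded_operator X (\<lambda>f x. c * A f x)"
proof -
  obtain K where K: "K \<ge> 0" "\<And>f. f \<in> ell2 X \<Longrightarrow> ell2_norm X (A f) \<le> K * ell2_norm X f"
    using A by (rule bounded_operator_bound) blast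
  have "ell2_norm X (\<lambda>x. c * A f x) \<le> (cmod c * K) * ell2_norm X f" if "f \<in> ell2 X" for f
    using mult_left_mono[OF K(2)[OF that] norm_ge_zero[of c]]
    by (simp add: ell2_scale bounded_operatorD[OF A that] bounded_operator_ell2[OF A that] mult.assoc)
  then show ?thesis
    by (intro bounded_operatorI[where K = "cmod c * K"])
      (simp_all add: bounded_operatorD[OF A] ell2_scale distrib_left mult.left_commute)
qed

lemma bounded_operator_id: "bounded_operator X (\<lambda>f. f)"
  by (rule bounded_operatorI[where K = 1]) simp_all

section \<open>Invertible operators\<close>

definition invertible_on :: "'a set \<Rightarrow> (('a \<Rightarrow> complex) \<Rightarrow> 'a \<Rightarrow> complex) \<Rightarrow> bool" where
  "invertible_on X A \<longleftrightarrow>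
     (\<exists>B. bounded_operator X B \<and> (\<forall>f\<in>ell2 X. B (A f) = f \<and> A (B f) = f))"

lemma spectrum_iff_not_invertible:
  "l \<in> spectrum X A \<longleftrightarrow> \<not> invertible_on X (\<lambda>f x. A f x - l * f x)"
  by (simp add: spectrum_def invertible_on_def)

lemma invertible_on_cong:
  assumes "\<And>f. f \<in> ell2 X \<Longrightarrow> A f = A' f" and "invertible_on X A'"
  shows "invertible_on X A"
proof -
  obtain B where B: "bounded_operator X B" "\<And>f. f \<in> ell2 X \<Longrightarrow> B (A' f) = f \<and> A' (B f) = f"
    using assms(2) by (auto simp: invertible_on_def)
  then show ?thesis
    unfolding invertible_on_def using assms(1) bounded_operator_ell2[OF B(1)]
    by (intro exI[of _ B]) simp
qed

lemma invertible_on_compose: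
  assumes A: "bounded_operator X A" and "invertible_on X A"
    and C: "bounded_operator X C" and "invertible_on X C"
  shows "invertible_on X (\<lambda>f. A (C f))"
proof -
  obtain A' where A': "bounded_operator X A'" "\<And>f. f \<in> ell2 X \<Longrightarrow> A' (A f) = f \<and> A (A' f) = f"
    using assms(2) by (auto simp: invertible_on_def)
  obtain C' where C': "bounded_operator X C'" "\<And>f. f \<in> ell2 X \<Longrightarrow> C' (C f) = f \<and> C (C' f) = f"
    using assms(4) by (auto simp: invertible_on_def)
  show ?thesis
    unfolding invertible_on_def
    using bounded_operator_compose[OF C'(1) A'(1)]
    by (intro exI[of _ "\<lambda>f. C' (A' f)"])
      (simp add: A' C' bounded_operatorD[OF A'(1)] bounded_operatorD[OF C])
qed

lemma invertible_on_scale: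
  assumes A: "bounded_operator X A" "invertible_on X A" and c: "c \<noteq> 0"
  shows "invertible_on X (\<lambda>f x. c * A f x)"
proof -
  have "invertible_on X (\<lambda>f x. c * f x)"
    unfolding invertible_on_def
    using bounded_operator_times[OF bounded_operator_id, of X "1 / c"] c
    by (intro exI[of _ "\<lambda>f x. (1 / c) * f x"]) simp
  from invertible_on_compose[OF bounded_operator_times[OF bounded_operator_id, of X c] this A]
  show ?thesis .
qed

text \<open>The left inverse and the right inverse that \<open>A C = C A\<close> provides for \<open>A\<close> agree.\<close>

lemma invertible_on_commuting_factor:
  assumes A: "bounded_operator X A" and C: "bounded_operator X C"
    and comm: "\<And>f. f \<in> ell2 X \<Longrightarrow> A (C f) = C (A f)"
    and inv: "invertible_on X (\<lambda>f. A (C f))"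
  shows "invertible_on X A"
proof -
  obtain J where J: "bounded_operator X J" "\<And>f. f \<in> ell2 X \<Longrightarrow> J (A (C f)) = f \<and> A (C (J f)) = f"
    using inv by (auto simp: invertible_on_def)
  have left: "J (C (A f)) = f" if "f \<in> ell2 X" for f
    using J(2)[OF that] comm[OF that] by simp
  have "J (C f) = C (J f)" if "f \<in> ell2 X" for f
    using left[of "C (J f)"] J(2)[OF that] that by (simp add: bounded_operatorD[OF J(1)] bounded_operatorD[OF C])
  then have "A (J (C f)) = f" if "f \<in> ell2 X" for f
    using J(2)[OF that] that by simp
  then show ?thesis
    unfolding invertible_on_def
    using left bounded_operator_compose[OF J(1) C]
    by (intro exI[of _ "\<lambda>f. J (C f)"]) simp
qed

text \<open>The sum is taken pointwise.  On every finite set the triangle inequality bounds its partial sums by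
  the geometric series, and the bound passes to the limit.\<close>

lemma ell2_suminf_geometric:
  assumes u: "\<And>n. u n \<in> ell2 X" and bd: "\<And>n. ell2_norm X (u n) \<le> r ^ n * K"
    and r: "0 \<le> r" "r < 1"
  shows "summable (\<lambda>n. u n x)"
    and "(\<lambda>x. \<Sum>n. u n x) \<in> ell2 X" and "ell2_norm X (\<lambda>x. \<Sum>n. u n x) \<le> K / (1 - r)"
proof -
  have K: "0 \<le> K" using bd[of 0] ell2_norm_nonneg[of X "u 0"] by simp
  have geo: "summable (\<lambda>n. r ^ n * K)" using r by (intro summable_mult2 summable_geometric) simp
  have summ: "summable (\<lambda>n. u n x)" for x
    by (rule summable_comparison_test'[OF geo, of 0])
      (use cmod_le_ell2_norm[OF u] bd order_trans in blast)
  show "summable (\<lambda>n. u n x)" by (rule summ)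
  have partial: "(\<lambda>x. \<Sum>n<N. u n x) \<in> ell2 X \<and> ell2_norm X (\<lambda>x. \<Sum>n<N. u n x) \<le> (\<Sum>n<N. r ^ n * K)" for N
  proof (induction N)
    case 0
    show ?case using ell2_0[of X] ell2_scale(2)[OF ell2_0, of X 0] by simp
  next
    case (Suc N)
    then show ?case
      using ell2_add[of "\<lambda>x. \<Sum>n<N. u n x" X "u N"] u[of N] bd[of N] by simp
  qed
  have "L2_set (\<lambda>x. cmod (\<Sum>n. u n x)) F \<le> K / (1 - r)" if F: "finite F" "F \<subseteq> X" for F
  proof (rule LIMSEQ_le_const2)
    show "(\<lambda>N. L2_set (\<lambda>x. cmod (\<Sum>n<N. u n x)) F) \<longlonglongrightarrow> L2_set (\<lambda>x. cmod (\<Sum>n. u n x)) F"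
      unfolding L2_set_def using summable_LIMSEQ[OF summ]
      by (intro tendsto_real_sqrt tendsto_sum tendsto_power tendsto_norm)
    have "(\<Sum>n<N. r ^ n * K) \<le> K / (1 - r)" for N
    proof -
      have "(\<Sum>n<N. r ^ n * K) \<le> (\<Sum>n. r ^ n * K)"
        using r K by (intro sum_le_suminf geo) auto
      also have "\<dots> = K / (1 - r)"
        using r by (simp add: suminf_mult2[symmetric] suminf_geometric summable_geometric)
      finally show ?thesis .
    qed
    then show "\<exists>N. \<forall>n\<ge>N. L2_set (\<lambda>x. cmod (\<Sum>k<n. u k x)) F \<le> K / (1 - r)"
      using partial L2_set_le_ell2_norm[OF _ F] order_trans by meson
  qed
  moreover have "(\<Sum>n. u n x) = 0" if "x \<notin> X" for x
    using ell2_zero_outside[OF u that] by simp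
  ultimately show "(\<lambda>x. \<Sum>n. u n x) \<in> ell2 X" "ell2_norm X (\<lambda>x. \<Sum>n. u n x) \<le> K / (1 - r)"
    using ell2_finite_bound[of X "\<lambda>x. \<Sum>n. u n x"] by blast+
qed

text \<open>The inverse is the Neumann series \<open>B f = \<Sum>\<^sub>n z\<^sup>n T\<^sup>n f\<close>, which satisfies \<open>B f = f + z B (T f)\<close> by
  splitting off its first term.\<close>

lemma invertible_on_one_minus_contraction:
  assumes T: "bounded_operator X T" and contr: "\<And>f. f \<in> ell2 X \<Longrightarrow> ell2_norm X (T f) \<le> ell2_norm X f"
    and z: "cmod z < 1"
  shows "invertible_on X (\<lambda>f x. f x - z * T f x)"
proof -
  define u where "u f n = (\<lambda>x. z ^ n * (T ^^ n) f x)" for f n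
  define B where "B f = (\<lambda>x. \<Sum>n. u f n x)" for f
  have pow: "(T ^^ n) f \<in> ell2 X" "ell2_norm X ((T ^^ n) f) \<le> ell2_norm X f" if "f \<in> ell2 X" for f n
  proof -
    have "(T ^^ n) f \<in> ell2 X \<and> ell2_norm X ((T ^^ n) f) \<le> ell2_norm X f"
      by (induction n) (use that bounded_operator_ell2[OF T] in \<open>auto intro: order_trans[OF contr]\<close>)
    then show "(T ^^ n) f \<in> ell2 X" "ell2_norm X ((T ^^ n) f) \<le> ell2_norm X f" by auto
  qed
  have u: "u f n \<in> ell2 X" "ell2_norm X (u f n) \<le> cmod z ^ n * ell2_norm X f" if "f \<in> ell2 X" for f n
    unfolding u_def using pow[OF that, of n]
    by (simp_all add: ell2_scale norm_power mult_left_mono)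
  note geo = ell2_suminf_geometric[where r = "cmod z", OF u norm_ge_zero z]
  have pow_add: "(T ^^ n) (\<lambda>x. f x + g x) = (\<lambda>x. (T ^^ n) f x + (T ^^ n) g x)"
    if "f \<in> ell2 X" "g \<in> ell2 X" for f g n
    by (induction n) (use that pow bounded_operator_add[OF T] in auto)
  have pow_scale: "(T ^^ n) (\<lambda>x. c * f x) = (\<lambda>x. c * (T ^^ n) f x)" if "f \<in> ell2 X" for c f n
    by (induction n) (use that pow bounded_operator_scale[OF T] in auto)
  have B: "bounded_operator X B"
  proof (rule bounded_operatorI[where K = "1 / (1 - cmod z)"])
    fix f g :: "'a \<Rightarrow> complex" and c
    assume f: "f \<in> ell2 X"
    show "B f \<in> ell2 X" "ell2_norm X (B f) \<le> 1 / (1 - cmod z) * ell2_norm X f"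
      using geo[OF f f] by (simp_all add: B_def)
    show "B (\<lambda>x. c * f x) = (\<lambda>x. c * B f x)"
      using geo(1)[OF f f] by (simp add: B_def u_def pow_scale[OF f] suminf_mult mult.left_commute)
    assume g: "g \<in> ell2 X"
    show "B (\<lambda>x. f x + g x) = (\<lambda>x. B f x + B g x)"
      using suminf_add[OF geo(1)[OF f f] geo(1)[OF g g]]
      by (simp add: B_def u_def pow_add[OF f g] distrib_left)
  qed
  have split: "B f = (\<lambda>x. f x + z * B (T f) x)" if f: "f \<in> ell2 X" for f
  proof
    fix x
    have "B f x = (\<Sum>n. u f (Suc n) x) + u f 0 x"
      unfolding B_def using suminf_split_head[OF geo(1)[OF f f, of x]] by simp
    moreover have "u f (Suc n) x = z * u (T f) n x" for n
      by (simp add: u_def funpow_swap1)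
    ultimately show "B f x = f x + z * B (T f) x"
      using geo(1)[OF bounded_operator_ell2[OF T f] bounded_operator_ell2[OF T f]]
      by (simp add: B_def suminf_mult) (simp add: u_def)
  qed
  \<comment> \<open>A bounded operator need not commute with pointwise sums for formal reasons.  But the defect
    \<open>E f = T (B f) - B (T f)\<close> satisfies \<open>E f = z E (T f)\<close>, so it is smaller than any \<open>|z|\<^sup>k\<close>.\<close>
  have comm: "T (B f) = B (T f)" if f: "f \<in> ell2 X" for f
  proof -
    define E where "E f = (\<lambda>x. T (B f) x + (-1) * B (T f) x)" for f
    have TB: "T (B f) \<in> ell2 X" "B (T f) \<in> ell2 X" if "f \<in> ell2 X" for f
      using that bounded_operator_ell2[OF T] bounded_operator_ell2[OF B] by auto
    have E: "E f \<in> ell2 X" if "f \<in> ell2 X" for f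
      unfolding E_def using TB[OF that] by (intro ell2_add ell2_scale)
    have E_norm: "ell2_norm X (E f) \<le> 2 / (1 - cmod z) * ell2_norm X f" if f: "f \<in> ell2 X" for f
    proof -
      have "ell2_norm X (E f) \<le> ell2_norm X (T (B f)) + ell2_norm X (B (T f))"
        unfolding E_def using ell2_add(2)[OF TB(1)[OF f] ell2_scale(1)[OF TB(2)[OF f], of "-1"]]
        by (simp only: ell2_scale(2)[OF TB(2)[OF f]] norm_minus_cancel norm_one mult_1)
      also have "\<dots> \<le> ell2_norm X (B f) + ell2_norm X (B (T f))"
        using contr[OF bounded_operator_ell2[OF B f]] by simp
      also have "\<dots> \<le> ell2_norm X f / (1 - cmod z) + ell2_norm X (T f) / (1 - cmod z)"
        using geo(3)[OF f f] geo(3)[OF bounded_operator_ell2[OF T f] bounded_operator_ell2[OF T f]]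
        by (simp add: B_def)
      also have "\<dots> \<le> ell2_norm X f / (1 - cmod z) + ell2_norm X f / (1 - cmod z)"
        using contr[OF f] z by (intro add_left_mono divide_right_mono) simp_all
      finally show ?thesis by simp
    qed
    have step: "E f = (\<lambda>x. z * E (T f) x)" if f: "f \<in> ell2 X" for f
    proof -
      have Tf: "T f \<in> ell2 X" using f by (rule bounded_operator_ell2[OF T])
      have "T (B f) = (\<lambda>x. T f x + z * T (B (T f)) x)"
        using split[OF f] bounded_operator_add[OF T f ell2_scale(1)[OF bounded_operator_ell2[OF B Tf]]]
          bounded_operator_scale[OF T bounded_operator_ell2[OF B Tf]] by simp
      with split[OF Tf] show ?thesis by (simp add: E_def fun_eq_iff algebra_simps)
    qed
    have "ell2_norm X (E f) \<le> cmod z ^ k * (2 / (1 - cmod z) * ell2_norm X f)" if f: "f \<in> ell2 X" for f k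
      using f
    proof (induction k arbitrary: f)
      case 0
      then show ?case using E_norm by simp
    next
      case (Suc k)
      have Tf: "T f \<in> ell2 X" using Suc.prems by (rule bounded_operator_ell2[OF T])
      have "ell2_norm X (E f) = cmod z * ell2_norm X (E (T f))"
        using step[OF Suc.prems] ell2_scale(2)[OF E[OF Tf], of z] by simp
      also have "\<dots> \<le> cmod z * (cmod z ^ k * (2 / (1 - cmod z) * ell2_norm X (T f)))"
        by (rule mult_left_mono[OF Suc.IH[OF Tf] norm_ge_zero])
      also have "\<dots> \<le> cmod z * (cmod z ^ k * (2 / (1 - cmod z) * ell2_norm X f))"
        using contr[OF Suc.prems] z by (intro mult_left_mono) auto
      finally show ?case by (simp add: mult.assoc)
    qed
    moreover have "(\<lambda>k. cmod z ^ k * (2 / (1 - cmod z) * ell2_norm X f)) \<longlonglongrightarrow> 0"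
      using z by (intro tendsto_mult_left_zero LIMSEQ_realpow_zero) auto
    ultimately have "ell2_norm X (E f) \<le> 0"
      using f by (intro LIMSEQ_le_const[where X = "\<lambda>k. cmod z ^ k * (2 / (1 - cmod z) * ell2_norm X f)"]) auto
    from ell2_norm_eq_0[OF E[OF f] this] show ?thesis
      by (simp add: E_def fun_eq_iff)
  qed
  have "B (\<lambda>x. f x - z * T f x) = (\<lambda>x. B f x - z * B (T f) x)" if f: "f \<in> ell2 X" for f
    using bounded_operator_add[OF B f ell2_scale(1)[OF bounded_operator_ell2[OF T f]], of "- z"]
      bounded_operator_scale[OF B bounded_operator_ell2[OF T f], of "- z"] by simp
  then have "B (\<lambda>x. f x - z * T f x) = f \<and> (\<lambda>x. B f x - z * T (B f) x) = f" if "f \<in> ell2 X" for f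
    unfolding comm[OF that] using fun_cong[OF split[OF that]] that by simp
  then show ?thesis
    unfolding invertible_on_def using B by blast
qed

section \<open>The spectrum of a combination of two reflections\<close>

text \<open>The two roots of \<open>z\<^sup>2 - t z + 1\<close> have product 1.  If they lie on the unit circle they are conjugate,
  and their sum \<open>t\<close> is a real number in \<open>[-2, 2]\<close>; otherwise one of them lies inside.\<close>

lemma exists_root_in_disc:
  fixes t :: complex
  assumes "\<not> (\<exists>x::real. -2 \<le> x \<and> x \<le> 2 \<and> t = of_real x)"
  shows "\<exists>z. z \<noteq> 0 \<and> cmod z < 1 \<and> z * t = 1 + z\<^sup>2"
proof -
  define w where "w = (t + csqrt (t\<^sup>2 - 4)) / 2"
  define c where "c = csqrt (t\<^sup>2 - 4)"
  have c: "c\<^sup>2 = t\<^sup>2 - 4" unfolding c_def by (rule power2_csqrt)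
  have "4 * (w * t) = 4 + (2 * t\<^sup>2 + 2 * t * c - 4)"
    unfolding w_def c_def[symmetric] by (simp add: power2_eq_square algebra_simps)
  also have "\<dots> = 4 + (t + c)\<^sup>2" by (simp add: power2_sum c)
  also have "\<dots> = 4 * (1 + w\<^sup>2)"
    unfolding w_def c_def[symmetric] by (simp add: power_divide)
  finally have w: "w * t = 1 + w\<^sup>2" by (rule mult_left_cancel[THEN iffD1, rotated]) simp
  then have w0: "w \<noteq> 0" by auto
  have "cmod w \<noteq> 1"
  proof
    assume 1: "cmod w = 1"
    then have c: "w * cnj w = 1" by (simp add: complex_norm_square[symmetric])
    have "w * t = w * (cnj w + w)" using w c by (simp add: distrib_left power2_eq_square)
    then have "t = of_real (2 * Re w)"
      using w0 complex_add_cnj[of w] by (simp add: add.commute)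
    moreover have "\<bar>Re w\<bar> \<le> 1" using abs_Re_le_cmod[of w] 1 by simp
    ultimately show False using assms by (metis abs_le_iff mult_2 add_mono neg_le_iff_le minus_add_distrib minus_le_iff one_add_one)
  qed
  then consider "cmod w < 1" | "cmod (1 / w) < 1" using w0 by (fastforce simp: norm_divide divide_simps)
  moreover have "(1 / w) * t = 1 + (1 / w)\<^sup>2"
    using w w0 by (simp add: power2_eq_square field_simps)
  ultimately show ?thesis using w w0 by (metis divide_eq_0_iff zero_neq_one)
qed

text \<open>For reflections \<open>A\<close> and \<open>V\<close> one has \<open>(A + 2V)\<^sup>2 = 5 + 2(AV + VA)\<close>, where \<open>AV\<close> and \<open>VA\<close> are
  contractions inverse to each other.  Hence \<open>(A + 2V - m)(A + 2V + m) = 5 - m\<^sup>2 + 2(AV + VA)\<close>, and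
  if \<open>z + 1 / z = (m\<^sup>2 - 5) / 2\<close> with \<open>|z| < 1\<close> this is the product of \<open>-2 / z\<close> and
  the two Neumann-invertible operators \<open>1 - zAV\<close> and \<open>1 - zVA\<close>.\<close>

lemma invertible_on_two_reflections:
  assumes A: "bounded_operator X A" and A_contr: "\<And>f. f \<in> ell2 X \<Longrightarrow> ell2_norm X (A f) \<le> ell2_norm X f"
    and A_inv: "\<And>f. f \<in> ell2 X \<Longrightarrow> A (A f) = f"
    and V: "bounded_operator X V" and V_contr: "\<And>f. f \<in> ell2 X \<Longrightarrow> ell2_norm X (V f) \<le> ell2_norm X f"
    and V_inv: "\<And>f. f \<in> ell2 X \<Longrightarrow> V (V f) = f"
    and m: "\<not> (\<exists>x::real. 1 \<le> \<bar>x\<bar> \<and> \<bar>x\<bar> \<le> 3 \<and> m = of_real x)"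
  shows "invertible_on X (\<lambda>f x. A f x + 2 * V f x - m * f x)"
proof -
  \<comment> \<open>\<open>t\<close> is the value of \<open>AV + VA\<close> that corresponds to the value \<open>m\<close> of \<open>A + 2V\<close>.\<close>
  define t where "t = (m\<^sup>2 - 5) / 2"
  have "\<not> (\<exists>x::real. -2 \<le> x \<and> x \<le> 2 \<and> t = of_real x)"
  proof
    assume "\<exists>x::real. -2 \<le> x \<and> x \<le> 2 \<and> t = of_real x"
    then obtain x :: real where x: "-2 \<le> x" "x \<le> 2" "t = of_real x" by blast
    then have "m\<^sup>2 = of_real (5 + 2 * x)" by (simp add: t_def field_simps)
    also have "\<dots> = (of_real (sqrt (5 + 2 * x)))\<^sup>2"
      using x by (simp only: of_real_power[symmetric]) (simp add: real_sqrt_pow2)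
    finally have "m = of_real (sqrt (5 + 2 * x)) \<or> m = of_real (- sqrt (5 + 2 * x))"
      by (simp add: power2_eq_iff)
    moreover have "1 \<le> sqrt (5 + 2 * x)" "sqrt (5 + 2 * x) \<le> 3"
      using x by (auto intro: real_le_lsqrt)
    ultimately show False using m by (metis abs_minus_cancel abs_of_nonneg order_trans zero_le_one)
  qed
  then obtain z where z: "z \<noteq> 0" "cmod z < 1" "z * t = 1 + z\<^sup>2"
    using exists_root_in_disc by blast
  define P where "P c f = (\<lambda>x. A f x + (2 * V f x + c * f x))" for c f
  define T where "T f = A (V f)" for f
  define T' where "T' f = V (A f)" for f
  note bnd = bounded_operator_plus bounded_operator_times bounded_operator_id
  have P: "bounded_operator X (P c)" for c
    unfolding P_def by (intro bnd A V)
  have T: "bounded_operator X T" "bounded_operator X T'"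
    unfolding T_def T'_def by (rule bounded_operator_compose[OF A V], rule bounded_operator_compose[OF V A])
  note mem = bounded_operator_ell2[OF A] bounded_operator_ell2[OF V] ell2_add(1) ell2_scale(1)
  have PP: "P c (P d f) = (\<lambda>x. (5 + c * d) * f x + 2 * (T f x + T' f x) + (c + d) * (A f x + 2 * V f x))"
    if f: "f \<in> ell2 X" for c d f
    unfolding P_def T_def T'_def
    by (simp add: f mem bounded_operatorD[OF A] bounded_operatorD[OF V] A_inv V_inv)
      (simp add: algebra_simps)
  define N where "N f = (\<lambda>x. f x - z * T f x)" for f
  define N' where "N' f = (\<lambda>x. f x - z * T' f x)" for f
  have NN: "N (N' f) = (\<lambda>x. (1 + z\<^sup>2) * f x - z * (T f x + T' f x))" if f: "f \<in> ell2 X" for f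
  proof -
    have "T (N' f) = (\<lambda>x. T f x - z * f x)"
      using bounded_operator_add[OF T(1) f ell2_scale(1)[OF bounded_operator_ell2[OF T(2) f]], of "- z"]
        bounded_operator_scale[OF T(1) bounded_operator_ell2[OF T(2) f], of "- z"]
      by (simp add: N'_def T_def T'_def f A_inv V_inv mem)
    then show ?thesis by (simp add: N_def N'_def algebra_simps power2_eq_square)
  qed
  have "invertible_on X N"
    unfolding N_def using A_contr V_contr mem(2)
    by (intro invertible_on_one_minus_contraction T z) (auto simp: T_def intro: order_trans)
  moreover have "invertible_on X N'"
    unfolding N'_def using A_contr V_contr mem(1)
    by (intro invertible_on_one_minus_contraction T z) (auto simp: T'_def intro: order_trans)
  moreover have bN: "bounded_operator X N" "bounded_operator X N'"
    using bnd(1)[OF bounded_operator_id bnd(2)[OF T(1), of "- z"]]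
      bnd(1)[OF bounded_operator_id bnd(2)[OF T(2), of "- z"]] by (simp_all add: N_def[abs_def] N'_def[abs_def])
  ultimately have "invertible_on X (\<lambda>f x. (- 2 / z) * N (N' f) x)"
    using z by (intro invertible_on_scale invertible_on_compose[OF bN(1) _ bN(2)]
        bounded_operator_compose[OF bN]) auto
  moreover have "P (- m) (P m f) = (\<lambda>x. (- 2 / z) * N (N' f) x)" if f: "f \<in> ell2 X" for f
  proof
    fix x
    have "5 - m\<^sup>2 = - 2 / z * (1 + z\<^sup>2)" using z by (simp add: t_def field_simps)
    then show "P (- m) (P m f) x = (- 2 / z) * N (N' f) x"
      using z(1) by (simp add: PP[OF f] NN[OF f] right_diff_distrib power2_eq_square mult.assoc[symmetric])
  qed
  ultimately have "invertible_on X (\<lambda>f. P (- m) (P m f))"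
    by (rule invertible_on_cong[rotated])
  then have "invertible_on X (P (- m))"
    by (rule invertible_on_commuting_factor[OF P P, rotated]) (simp add: PP)
  then show ?thesis by (simp add: P_def[abs_def] algebra_simps)
qed

text \<open>On approximate eigenvectors an inverse of \<open>A - l\<close> would have unbounded norm.\<close>

lemma approximate_eigenvalue_in_spectrum:
  assumes A: "bounded_operator X A"
    and approx: "\<And>e. e > 0 \<Longrightarrow> \<exists>f\<in>ell2 X. f \<noteq> (\<lambda>_. 0) \<and> ell2_norm X (\<lambda>x. A f x - l * f x) \<le> e * ell2_norm X f"
  shows "l \<in> spectrum X A"
proof (rule ccontr)
  assume "l \<notin> spectrum X A"
  then obtain B where B: "bounded_operator X B" "\<And>f. f \<in> ell2 X \<Longrightarrow> B (\<lambda>x. A f x - l * f x) = f"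
    by (auto simp: spectrum_def)
  obtain K where K: "K \<ge> 0" "\<And>f. f \<in> ell2 X \<Longrightarrow> ell2_norm X (B f) \<le> K * ell2_norm X f"
    using B(1) by (rule bounded_operator_bound) blast
  obtain f where f: "f \<in> ell2 X" "f \<noteq> (\<lambda>_. 0)"
    and le: "ell2_norm X (\<lambda>x. A f x - l * f x) \<le> 1 / (K + 1) * ell2_norm X f"
    using approx[of "1 / (K + 1)"] K(1) by auto
  have pos: "ell2_norm X f > 0"
    using ell2_norm_eq_0[OF f(1)] f(2) by force
  have "(\<lambda>x. A f x - l * f x) \<in> ell2 X"
    using ell2_add(1)[OF bounded_operator_ell2[OF A f(1)] ell2_scale(1)[OF f(1), of "- l"]] by simp
  from K(2)[OF this] have "ell2_norm X f \<le> K * ell2_norm X (\<lambda>x. A f x - l * f x)"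
    by (simp add: B(2)[OF f(1)])
  also have "\<dots> \<le> K * (1 / (K + 1) * ell2_norm X f)"
    using le K(1) by (intro mult_left_mono)
  also have "\<dots> < ell2_norm X f"
    using pos K(1) by (simp add: field_simps)
  finally show False by simp
qed

section \<open>Groups generated by an involution and a Klein four-group\<close>

text \<open>For an involution \<open>k\<close> this is the summand of the Markov operator that belongs to \<open>k\<close>.\<close>

definition translate :: "('g, 'm) monoid_scheme \<Rightarrow> 'g \<Rightarrow> ('g \<Rightarrow> complex) \<Rightarrow> 'g \<Rightarrow> complex" where
  "translate G k f = (\<lambda>g. if g \<in> carrier G then f (k \<otimes>\<^bsub>G\<^esub> g) else 0)"

context group
begin

lemma bij_betw_mult_left: "k \<in> carrier G \<Longrightarrow> bij_betw (\<lambda>g. k \<otimes> g) (carrier G) (carrier G)"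
  by (rule bij_betwI[where g = "\<lambda>g. inv k \<otimes> g"]) (auto simp: m_assoc[symmetric])

lemma translate_ell2:
  assumes k: "k \<in> carrier G" and f: "f \<in> ell2 (carrier G)"
  shows "translate G k f \<in> ell2 (carrier G)"
    and "ell2_norm (carrier G) (translate G k f) = ell2_norm (carrier G) f"
proof -
  note bij = bij_betw_mult_left[OF k]
  have "(\<lambda>g. (cmod (f (k \<otimes> g)))\<^sup>2) summable_on carrier G"
    using f summable_on_reindex_bij_betw[OF bij, of "\<lambda>g. (cmod (f g))\<^sup>2"] by (simp add: ell2_def)
  then show "translate G k f \<in> ell2 (carrier G)"
    by (simp add: ell2_def translate_def cong: summable_on_cong)
  show "ell2_norm (carrier G) (translate G k f) = ell2_norm (carrier G) f"
    using infsum_reindex_bij_betw[OF bij, of "\<lambda>g. (cmod (f g))\<^sup>2"]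
    by (simp add: ell2_norm_def translate_def cong: infsum_cong)
qed

lemma bounded_operator_translate:
  "k \<in> carrier G \<Longrightarrow> bounded_operator (carrier G) (translate G k)"
  by (rule bounded_operatorI[where K = 1])
    (simp_all add: translate_ell2, auto simp: translate_def)

lemma translate_translate:
  "k \<in> carrier G \<Longrightarrow> l \<in> carrier G \<Longrightarrow> translate G k (translate G l f) = translate G (l \<otimes> k) f"
  by (auto simp: translate_def m_assoc)

lemma translate_one: "f \<in> ell2 (carrier G) \<Longrightarrow> translate G \<one> f = f"
  by (auto simp: translate_def ell2_zero_outside)

text \<open>This is \<open>2P - 1\<close> for the projection \<open>P = (1 + b + c + d) / 4\<close> onto the functions that are
  invariant under the four-group.\<close>

definition klein_reflection :: "'a \<Rightarrow> 'a \<Rightarrow> 'a \<Rightarrow> ('a \<Rightarrow> complex) \<Rightarrow> 'a \<Rightarrow> complex" where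
  "klein_reflection b c d f =
     (\<lambda>g. (translate G b f g + translate G c f g + translate G d f g - f g) / 2)"

end

text \<open>The four-by-four matrix with off-diagonal entries \<open>1/2\<close> and diagonal entries \<open>-1/2\<close> is orthogonal.\<close>

lemma sum_squares_reflection:
  fixes p q r s :: complex
  shows "(cmod (q + r + s - p) / 2)\<^sup>2 + (cmod (p + s + r - q) / 2)\<^sup>2
       + (cmod (s + p + q - r) / 2)\<^sup>2 + (cmod (r + q + p - s) / 2)\<^sup>2
       = (cmod p)\<^sup>2 + (cmod q)\<^sup>2 + (cmod r)\<^sup>2 + (cmod s)\<^sup>2"
  unfolding power_divide cmod_power2 by (simp add: power2_eq_square field_simps)

locale involution_and_klein_group = group +
  fixes a b c d
  assumes in_carrier: "a \<in> carrier G" "b \<in> carrier G" "c \<in> carrier G" "d \<in> carrier G"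
    and involutions: "a \<otimes> a = \<one>" "b \<otimes> b = \<one>" "c \<otimes> c = \<one>" "d \<otimes> d = \<one>"
    and klein: "b \<otimes> c = d" "c \<otimes> b = d" "b \<otimes> d = c" "d \<otimes> b = c" "c \<otimes> d = b" "d \<otimes> c = b"
    and card_gens: "card {a, b, c, d} = 4"
begin

abbreviation "A \<equiv> translate G a"
abbreviation "V \<equiv> klein_reflection b c d"

lemma bounded_operator_V: "bounded_operator (carrier G) V"
proof -
  have "bounded_operator (carrier G) (\<lambda>f g. (1/2) * ((translate G b f g + translate G c f g)
     + (translate G d f g + (- 1) * f g)))"
    by (intro bounded_operator_times bounded_operator_plus bounded_operator_translate
        bounded_operator_id in_carrier)
  also have "(\<lambda>f g. (1/2) * ((translate G b f g + translate G c f g)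
     + (translate G d f g + (- 1) * f g))) = V"
    by (simp add: klein_reflection_def fun_eq_iff)
  finally show ?thesis .
qed

lemma klein_assoc:
  assumes "g \<in> carrier G"
  shows "b \<otimes> (b \<otimes> g) = g" "c \<otimes> (c \<otimes> g) = g" "d \<otimes> (d \<otimes> g) = g"
    "b \<otimes> (c \<otimes> g) = d \<otimes> g" "c \<otimes> (b \<otimes> g) = d \<otimes> g" "b \<otimes> (d \<otimes> g) = c \<otimes> g"
    "d \<otimes> (b \<otimes> g) = c \<otimes> g" "c \<otimes> (d \<otimes> g) = b \<otimes> g" "d \<otimes> (c \<otimes> g) = b \<otimes> g"
  using assms in_carrier by (simp_all add: m_assoc[symmetric] involutions klein)

lemma V_involution: "f \<in> ell2 (carrier G) \<Longrightarrow> V (V f) = f"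
  by (rule ext)
    (auto simp: klein_reflection_def translate_def in_carrier klein_assoc ell2_zero_outside field_simps)

text \<open>Pointwise \<open>V\<close> preserves the sum of squares over each orbit of the four-group.  Adding these identities
  over all group elements counts every orbit four times on both sides.\<close>

lemma V_isometry:
  assumes f: "f \<in> ell2 (carrier G)"
  shows "ell2_norm (carrier G) (V f) = ell2_norm (carrier G) f"
proof -
  have sum4: "4 * (\<Sum>\<^sub>\<infinity>g\<in>carrier G. (cmod (h g))\<^sup>2) = (\<Sum>\<^sub>\<infinity>g\<in>carrier G.
      (cmod (h g))\<^sup>2 + (cmod (h (b \<otimes> g)))\<^sup>2 + (cmod (h (c \<otimes> g)))\<^sup>2 + (cmod (h (d \<otimes> g)))\<^sup>2)"
    if h: "h \<in> ell2 (carrier G)" for h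
  proof -
    let ?q = "\<lambda>g. (cmod (h g))\<^sup>2"
    have s: "?q summable_on carrier G" using h by (simp add: ell2_def)
    have sk: "(\<lambda>g. ?q (k \<otimes> g)) summable_on carrier G"
      "(\<Sum>\<^sub>\<infinity>g\<in>carrier G. ?q (k \<otimes> g)) = (\<Sum>\<^sub>\<infinity>g\<in>carrier G. ?q g)" if "k \<in> carrier G" for k
      using s summable_on_reindex_bij_betw[OF bij_betw_mult_left[OF that], of ?q]
        infsum_reindex_bij_betw[OF bij_betw_mult_left[OF that], of ?q] by simp_all
    show ?thesis
      by (subst infsum_add | intro summable_on_add s sk in_carrier)+
        (simp add: sk in_carrier)
  qed
  have "4 * (\<Sum>\<^sub>\<infinity>g\<in>carrier G. (cmod (V f g))\<^sup>2) = 4 * (\<Sum>\<^sub>\<infinity>g\<in>carrier G. (cmod (f g))\<^sup>2)"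
    unfolding sum4[OF f] sum4[OF bounded_operator_ell2[OF bounded_operator_V f]]
    by (intro infsum_cong)
      (simp add: klein_reflection_def translate_def klein_assoc in_carrier
        sum_squares_reflection)
  then show ?thesis by (simp add: ell2_norm_def)
qed

lemma markov_eq:
  assumes "f \<in> ell2 (carrier G)"
  shows "markov G {a, b, c, d} f = (\<lambda>g. (1/4) * (f g + (A f g + 2 * V f g)))"
proof -
  have distinct: "a \<notin> {b, c, d}" "b \<notin> {c, d}" "c \<noteq> d"
    using card_gens by (auto simp: card_insert_if split: if_splits)
  have "inv a = a" "inv b = b" "inv c = c" "inv d = d"
    using in_carrier involutions by (simp_all add: inv_equality)
  then have "markov G {a, b, c, d} f g = (1/4) * (f g + (A f g + 2 * V f g))" for g
    using assms distinct
    by (cases "g \<in> carrier G")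
      (simp_all add: markov_def card_gens translate_def klein_reflection_def ell2_zero_outside field_simps)
  then show ?thesis by blast
qed

lemma bounded_operator_markov: "bounded_operator (carrier G) (markov G {a, b, c, d})"
proof -
  have "bounded_operator (carrier G) (\<lambda>f g. (1/4) * (f g + (A f g + 2 * V f g)))"
    by (intro bounded_operator_times bounded_operator_plus bounded_operator_id
        bounded_operator_translate bounded_operator_V in_carrier)
  then show ?thesis
    by (simp add: bounded_operator_def markov_eq ell2_add ell2_scale cong: ball_cong)
qed

text \<open>As \<open>4M - 1 = A + 2V\<close>, the point \<open>l\<close> corresponds to the point \<open>m = 4l - 1\<close> for the two reflections
  \<open>A\<close> and \<open>V\<close>.\<close>

lemma group_spectrum_subset:
  "group_spectrum G {a, b, c, d} \<subseteq> complex_of_real ` ({- 1/2 .. 0} \<union> {1/2 .. 1})"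
proof
  fix l assume l: "l \<in> group_spectrum G {a, b, c, d}"
  show "l \<in> complex_of_real ` ({- 1/2 .. 0} \<union> {1/2 .. 1})"
  proof (rule ccontr)
    assume notin: "l \<notin> complex_of_real ` ({- 1/2 .. 0} \<union> {1/2 .. 1})"
    have m: "\<not> (\<exists>x::real. 1 \<le> \<bar>x\<bar> \<and> \<bar>x\<bar> \<le> 3 \<and> 4 * l - 1 = of_real x)"
    proof
      assume "\<exists>x::real. 1 \<le> \<bar>x\<bar> \<and> \<bar>x\<bar> \<le> 3 \<and> 4 * l - 1 = of_real x"
      then obtain x :: real where x: "1 \<le> \<bar>x\<bar>" "\<bar>x\<bar> \<le> 3" "4 * l - 1 = of_real x" by blast
      then have "l = of_real ((x + 1) / 4)" by (simp add: field_simps)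
      moreover have "(x + 1) / 4 \<in> {- 1/2 .. 0} \<union> {1/2 .. 1}" using x(1,2) by (auto simp: abs_if split: if_splits)
      ultimately show False using notin by blast
    qed
    have "A (A f) = f" if "f \<in> ell2 (carrier G)" for f
      using that by (simp add: translate_translate in_carrier involutions translate_one)
    then have inv: "invertible_on (carrier G) (\<lambda>f g. A f g + 2 * V f g - (4 * l - 1) * f g)"
      by (intro invertible_on_two_reflections m bounded_operator_translate bounded_operator_V in_carrier)
        (simp_all add: translate_ell2 in_carrier V_isometry V_involution)
    have "bounded_operator (carrier G) (\<lambda>f g. (A f g + 2 * V f g) + (- (4 * l - 1)) * f g)"
      by (intro bounded_operator_times bounded_operator_plus bounded_operator_id
        bounded_operator_translate bounded_operator_V in_carrier)
    then have "bounded_operator (carrier G) (\<lambda>f g. A f g + 2 * V f g - (4 * l - 1) * f g)"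
      by (simp only: mult_minus_left add_uminus_conv_diff)
    from invertible_on_scale[OF this inv, of "1/4"]
    have "invertible_on (carrier G) (\<lambda>f g. markov G {a, b, c, d} f g - l * f g)"
      by (rule invertible_on_cong[rotated]) (simp_all add: markov_eq field_simps)
    then show False
      using l by (simp add: group_spectrum_def spectrum_iff_not_invertible)
  qed
qed

end

section \<open>The generators as recursive maps\<close>

fun flip :: "vertex \<Rightarrow> vertex" where
  "flip [] = []"
| "flip (x # v) = (\<not> x) # v"

text \<open>The directed automorphism whose section at \<open>1\<^sup>n0\<close> is \<open>flip\<close> if \<open>e n\<close>, and trivial otherwise.\<close>

fun directed :: "(nat \<Rightarrow> bool) \<Rightarrow> vertex \<Rightarrow> vertex" where
  "directed e [] = []"
| "directed e (False # v) = False # (if e 0 then flip v else v)"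
| "directed e (True # v) = True # directed (\<lambda>i. e (Suc i)) v"

lemma sigma_aut_0: "sigma_aut 0 = flip"
proof
  show "sigma_aut 0 v = flip v" for v
    by (cases v) (simp_all add: sigma_aut_def word_def)
qed

lemma sigma_aut_Suc:
  "sigma_aut (Suc n) (True # v) = True # (if n = 0 then v else sigma_aut n v)"
  "sigma_aut (Suc n) (False # v) = False # (if n = 0 then flip v else v)"
proof -
  show "sigma_aut (Suc n) (True # v) = True # (if n = 0 then v else sigma_aut n v)"
    by (cases n) (auto simp: sigma_aut_def word_def)
  show "sigma_aut (Suc n) (False # v) = False # (if n = 0 then flip v else v)"
    by (cases n; cases v) (auto simp: sigma_aut_def word_def)
qed

lemma partial_sigma_prod_False:
  assumes "0 \<notin> B"
  shows "partial_sigma_prod B (Suc (Suc N)) (False # v) = False # (if 1 \<in> B then flip v else v)"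
proof (induction N)
  case 0
  then show ?case using assms by (simp add: sigma_aut_Suc)
next
  case (Suc N)
  then show ?case
    by (simp add: sigma_aut_Suc partial_sigma_prod.simps(2)[of B "Suc (Suc N)"]
        del: partial_sigma_prod.simps)
qed

lemma partial_sigma_prod_True:
  assumes "0 \<notin> B" and B': "\<And>n. n \<in> B' \<longleftrightarrow> n \<ge> 1 \<and> Suc n \<in> B"
  shows "partial_sigma_prod B (Suc (Suc N)) (True # v) = True # partial_sigma_prod B' (Suc N) v"
proof (induction N arbitrary: v)
  case 0
  then show ?case using assms(1) by (simp add: sigma_aut_Suc B')
next
  case (Suc N)
  then show ?case
    by (simp add: sigma_aut_Suc partial_sigma_prod.simps(2)[of B "Suc (Suc N)"]
        partial_sigma_prod.simps(2)[of B' "Suc N"] B' del: partial_sigma_prod.simps)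
qed

text \<open>Of the factors \<open>\<sigma>\<^sub>n\<close> with \<open>n \<ge> 1\<close>, only \<open>\<sigma>\<^sub>1\<close> moves words that begin with \<open>0\<close>; on words that begin with
  \<open>1\<close> the others act as \<open>\<sigma>\<^sub>n\<^sub>-\<^sub>1\<close> on the rest of the word.\<close>

lemma sigma_prod_directed:
  assumes "0 \<notin> B"
  shows "sigma_prod B = directed (\<lambda>i. Suc i \<in> B)"
proof
  fix v
  have eq: "sigma_prod B u = partial_sigma_prod B (Suc (length u)) u" for B u
    using partial_sigma_prod_stable[of u "Suc (length u)" B] by (simp add: sigma_prod_eq)
  have "partial_sigma_prod B (Suc (length v)) v = directed (\<lambda>i. Suc i \<in> B) v"
    using assms
  proof (induction v arbitrary: B)
    case Nil
    then show ?case by (simp add: sigma_short)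
  next
    case (Cons x v)
    show ?case
    proof (cases x)
      case True
      then show ?thesis
        using Cons.IH[of "{n. n \<ge> 1 \<and> Suc n \<in> B}"] Cons.prems
        by (simp add: partial_sigma_prod_True[where B' = "{n. n \<ge> 1 \<and> Suc n \<in> B}"] del: partial_sigma_prod.simps)
    next
      case False
      then show ?thesis using Cons.prems
        by (simp add: partial_sigma_prod_False del: partial_sigma_prod.simps)
    qed
  qed
  then show "sigma_prod B v = directed (\<lambda>i. Suc i \<in> B) v" by (simp add: eq)
qed

lemma length_flip [simp]: "length (flip v) = length v"
  by (cases v) simp_all

lemma flip_flip [simp]: "flip (flip v) = v"
  by (cases v) simp_all

lemma length_directed [simp]: "length (directed e v) = length v"
  by (induction e v rule: directed.induct) simp_all

lemma directed_directed: "directed e (directed e' v) = directed (\<lambda>i. e i \<noteq> e' i) v"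
  by (induction e v arbitrary: e' rule: directed.induct) simp_all

lemma directed_False: "directed (\<lambda>_. False) v = v"
  by (induction "\<lambda>_::nat. False" v rule: directed.induct) simp_all

lemma directed_witness: "directed e (replicate i True @ [False, True]) = replicate i True @ [False, \<not> e i]"
  by (induction i arbitrary: e) simp_all

text \<open>The word \<open>1\<^sup>i01\<close> reads off the bit \<open>e i\<close>.\<close>

lemma directed_inj: "directed e = directed e' \<Longrightarrow> e = e'"
proof
  fix i assume "directed e = directed e'"
  then have "directed e (replicate i True @ [False, True]) = directed e' (replicate i True @ [False, True])" by simp
  then show "e i = e' i" by (simp add: directed_witness)
qed

section \<open>Words of fixed length on a path\<close>

text \<open>The words of length \<open>n\<close> form a path on which each generator moves a word by at most one step.
  It starts at \<open>1\<^sup>n\<close>, ends at \<open>1\<^sup>n\<^sup>-\<^sup>10\<close>, and the position of a word on it is a reflected Gray code: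
  \<open>flip\<close> exchanges the positions \<open>2 j\<close> and \<open>2 j + 1\<close>, and the directed maps exchange \<open>2 j + 1\<close> and
  \<open>2 j + 2\<close>.\<close>

fun pos :: "vertex \<Rightarrow> nat" where
  "pos [] = 0"
| "pos (x # w) = 2 * pos w + (if x = even (pos w) then 0 else 1)"

definition step_a :: "nat \<Rightarrow> nat" where
  "step_a j = (if even j then j + 1 else j - 1)"

definition step_v :: "nat \<Rightarrow> nat \<Rightarrow> nat" where
  "step_v N j = (if j = 0 \<or> j = N - 1 then j else if odd j then j + 1 else j - 1)"

lemma pos_less: "pos w < 2 ^ length w"
  by (induction w) auto

lemma pos_flip: "w \<noteq> [] \<Longrightarrow> pos (flip w) = step_a (pos w)"
  by (cases w) (auto simp: step_a_def)

lemma pow2_length_even: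
  assumes "w \<noteq> []"
  obtains k where "2 ^ length w = 2 * Suc k"
proof -
  have "(2::nat) ^ length w = 2 * Suc (2 ^ (length w - 1) - 1)"
    using assms by (cases w) simp_all
  then show ?thesis by (rule that)
qed

text \<open>The length of the initial block of ones decides which bit of \<open>e\<close> governs the action on \<open>w\<close>; it
  does not depend on \<open>e\<close>.  Hence of three directed maps whose bits are true twice at each index, two take
  the same step and one stays.\<close>

lemma pos_directed:
  "pos (directed e w) =
    (if e (length (takeWhile id w)) then step_v (2 ^ length w) (pos w) else pos w)"
proof (induction e w rule: directed.induct)
  case (1 e)
  then show ?case by (simp add: step_v_def)
next
  case (2 e v)
  show ?case
  proof (cases "v = []")
    case True
    then show ?thesis by (simp add: step_v_def)
  next
    case False
    then obtain k where k: "2 ^ length v = 2 * Suc k" by (rule pow2_length_even)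
    have "pos v < 2 * Suc k" using pos_less[of v] k by simp
    moreover have "4 * b \<noteq> Suc (Suc (4 * k))" for b by presburger
    ultimately show ?thesis
      using k False by (auto simp: pos_flip step_a_def step_v_def elim!: evenE oddE)
  qed
next
  case (3 e v)
  show ?case
  proof (cases "v = []")
    case True
    then show ?thesis by (simp add: step_v_def)
  next
    case False
    then obtain k where k: "2 ^ length v = 2 * Suc k" by (rule pow2_length_even)
    have "pos v < 2 * Suc k" using pos_less[of v] k by simp
    then show ?thesis
      using k False 3 by (auto simp: step_v_def elim!: evenE oddE)
  qed
qed

text \<open>Directed maps have a nontrivial section at level \<open>n\<close> only at the two ends of the path: a directed map
  again at \<open>1\<^sup>n\<close>, and \<open>flip\<close> or the identity at \<open>1\<^sup>n\<^sup>-\<^sup>10\<close>.\<close>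

lemma directed_append:
  "pos w = 0 \<Longrightarrow> directed e (w @ v) = directed e w @ directed (\<lambda>i. e (i + length w)) v"
  "w \<noteq> [] \<Longrightarrow> pos w = 2 ^ length w - 1 \<Longrightarrow>
     directed e (w @ v) = directed e w @ (if e (length w - 1) then flip v else v)"
  "pos w \<noteq> 0 \<Longrightarrow> pos w \<noteq> 2 ^ length w - 1 \<Longrightarrow> directed e (w @ v) = directed e w @ v"
proof -
  have "(pos w = 0 \<longrightarrow> directed e (w @ v) = directed e w @ directed (\<lambda>i. e (i + length w)) v) \<and>
     (w \<noteq> [] \<and> pos w = 2 ^ length w - 1 \<longrightarrow> directed e (w @ v) = directed e w @ (if e (length w - 1) then flip v else v)) \<and>
     (pos w \<noteq> 0 \<and> pos w \<noteq> 2 ^ length w - 1 \<longrightarrow> directed e (w @ v) = directed e w @ v)"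
  proof (induction e w rule: directed.induct)
    case (1 e)
    then show ?case by simp
  next
    case (2 e w)
    show ?case
    proof (cases "w = []")
      case True
      then show ?thesis by (cases v) simp_all
    next
      case False
      then obtain k where k: "2 ^ length w = 2 * Suc k" by (rule pow2_length_even)
      have "pos w < 2 * Suc k" using pos_less[of w] k by simp
      moreover have "4 * b \<noteq> Suc (Suc (4 * k))" for b by presburger
      moreover have "flip (w @ v) = flip w @ v" using False by (cases w) simp_all
      ultimately show ?thesis using k False by (auto elim!: evenE oddE)
    qed
  next
    case (3 e w)
    show ?case
    proof (cases "w = []")
      case True
      then show ?thesis by simp
    next
      case False
      then obtain k where k: "2 ^ length w = 2 * Suc k" by (rule pow2_length_even)
      have "pos w < 2 * Suc k" using pos_less[of w] k by simp
      moreover have "2 * b \<noteq> Suc (2 * k)" for b by presburger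
      ultimately show ?thesis using k False 3 by (auto elim!: evenE oddE)
    qed
  qed
  then show "pos w = 0 \<Longrightarrow> directed e (w @ v) = directed e w @ directed (\<lambda>i. e (i + length w)) v"
    "w \<noteq> [] \<Longrightarrow> pos w = 2 ^ length w - 1 \<Longrightarrow>
     directed e (w @ v) = directed e w @ (if e (length w - 1) then flip v else v)"
    "pos w \<noteq> 0 \<Longrightarrow> pos w \<noteq> 2 ^ length w - 1 \<Longrightarrow> directed e (w @ v) = directed e w @ v"
    by blast+
qed

section \<open>Eigenfunctions of the path\<close>

text \<open>The path of \<open>N\<close> points is the line folded by the reflections in \<open>-1/2\<close> and \<open>N - 1/2\<close>.  A
  function on the line of the form \<open>cos ((j + 1/2) \<theta>)\<close> with \<open>N \<theta> \<in> \<pi>\<int>\<close> is invariant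
  under both, and so is an eigenfunction of the sum of the two shifts by two.\<close>

definition wave :: "real \<Rightarrow> real \<Rightarrow> real" where
  "wave \<theta> x = cos ((x + 1/2) * \<theta>)"

text \<open>The wave is not an eigenfunction of \<open>O = A + 2V\<close> itself, where \<open>A\<close> and \<open>V\<close> are the two steps along the
  path; this is its image under \<open>O + \<mu>\<close>.\<close>

definition path_eigenfunction :: "nat \<Rightarrow> real \<Rightarrow> real \<Rightarrow> nat \<Rightarrow> real" where
  "path_eigenfunction N \<theta> \<mu> j =
     wave \<theta> (step_a j) + 2 * wave \<theta> (step_v N j) + \<mu> * wave \<theta> j"

lemma step_a_step_a: "step_a (step_a j) = j"
  by (auto simp: step_a_def)

lemma step_v_step_v: "even N \<Longrightarrow> j < N \<Longrightarrow> step_v N (step_v N j) = j"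
  unfolding step_v_def by (auto; presburger)

lemma step_a_less: "even N \<Longrightarrow> j < N \<Longrightarrow> step_a j < N"
  by (auto simp: step_a_def elim!: evenE)

context
  fixes N :: nat and \<theta> :: real and m :: int
  assumes N: "even N" "N > 0" and \<theta>: "real N * \<theta> = of_int m * pi"
begin

lemma wave_reflect_left: "wave \<theta> (-1 - x) = wave \<theta> x"
proof -
  have "(-1 - x + 1/2) * \<theta> = - ((x + 1/2) * \<theta>)" by (simp add: algebra_simps)
  then show ?thesis by (simp add: wave_def)
qed

lemma wave_reflect_right: "wave \<theta> (2 * real N - 1 - x) = wave \<theta> x"
proof -
  have "(2 * real N - 1 - x + 1/2) * \<theta> = 2 * (real N * \<theta>) - (x + 1/2) * \<theta>"
    by (simp add: algebra_simps)
  also have "\<dots> = - ((x + 1/2) * \<theta>) + of_int m * (2 * pi)" by (simp add: \<theta>)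
  finally have e: "(2 * real N - 1 - x + 1/2) * \<theta> = - ((x + 1/2) * \<theta>) + of_int m * (2 * pi)" .
  have "cos (y + of_int m * (2 * pi)) = cos y" for y
    using cos_int_2pin[of m] sin_int_2pin[of m] by (simp add: cos_add mult.commute)
  then show ?thesis unfolding wave_def e by (metis cos_minus)
qed

lemma wave_step_v:
  assumes "j < N"
  shows "wave \<theta> (step_v N j) = wave \<theta> (if odd j then real j + 1 else real j - 1)"
proof -
  consider "j = 0" | "j = N - 1" | "j \<noteq> 0" "j \<noteq> N - 1" by blast
  then show ?thesis
  proof cases
    case 1
    then show ?thesis using wave_reflect_left[of 0] by (simp add: step_v_def)
  next
    case 2
    then have "odd j" "real j = real N - 1" using N by (auto simp: of_nat_diff)
    then show ?thesis using wave_reflect_right[of "real N"] 2 by (simp add: step_v_def)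
  next
    case 3
    then show ?thesis by (auto simp: step_v_def of_nat_diff add.commute)
  qed
qed

lemma wave_sum_shifts:
  assumes j: "j < N"
  shows "wave \<theta> (step_v N (step_a j)) + wave \<theta> (step_a (step_v N j)) = 2 * cos (2 * \<theta>) * wave \<theta> j"
proof -
  have shifts: "wave \<theta> (x + 2) + wave \<theta> (x - 2) = 2 * cos (2 * \<theta>) * wave \<theta> x" for x
  proof -
    have "(x + 2 + 1/2) * \<theta> = (x + 1/2) * \<theta> + 2 * \<theta>" "(x - 2 + 1/2) * \<theta> = (x + 1/2) * \<theta> - 2 * \<theta>"
      by (simp_all add: algebra_simps)
    then show ?thesis unfolding wave_def by (simp only: cos_add cos_diff) simp
  qed
  have 1: "wave \<theta> (step_v N (step_a j)) = wave \<theta> (if even j then real j + 2 else real j - 2)"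
    using wave_step_v[OF step_a_less[OF N(1) j]] by (auto simp: step_a_def of_nat_diff add.commute elim!: oddE)
  have 2: "wave \<theta> (step_a (step_v N j)) = wave \<theta> (if even j then real j - 2 else real j + 2)"
  proof -
    consider "j = 0" | "j = N - 1" | "j \<noteq> 0" "j \<noteq> N - 1" by blast
    then show ?thesis
    proof cases
      case 1
      then show ?thesis using wave_reflect_left[of 1] by (simp add: step_v_def step_a_def)
    next
      case 2
      then have "odd j" "real j = real N - 1" "real (N - 2) = real N - 2" using N by (auto simp: of_nat_diff)
      then show ?thesis using wave_reflect_right[of "real N + 1"] 2
        by (simp add: step_v_def step_a_def add.commute)
    next
      case 3
      then show ?thesis using j by (auto simp: step_v_def step_a_def of_nat_diff add.commute elim!: evenE)
    qed
  qed
  show ?thesis using shifts[of "real j"] unfolding 1 2 by (auto simp: add.commute)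
qed

text \<open>As \<open>(O - \<mu>)(O + \<mu>) = 5 - \<mu>\<^sup>2 + 2(AV + VA)\<close> for \<open>O = A + 2V\<close>, the operator \<open>O + \<mu>\<close> turns the
  wave into an eigenfunction of \<open>O\<close>.\<close>

lemma path_eigenfunction:
  assumes \<mu>: "\<mu>\<^sup>2 = 1 + 8 * (cos \<theta>)\<^sup>2" and j: "j < N"
  shows "path_eigenfunction N \<theta> \<mu> (step_a j) + 2 * path_eigenfunction N \<theta> \<mu> (step_v N j)
    = \<mu> * path_eigenfunction N \<theta> \<mu> j"
proof -
  have "\<mu>\<^sup>2 = 5 + 4 * cos (2 * \<theta>)" using \<mu> by (simp add: cos_double_cos)
  then have "\<mu> * \<mu> * wave \<theta> j = (5 + 4 * cos (2 * \<theta>)) * wave \<theta> j" by (simp add: power2_eq_square)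
  then show ?thesis
    using wave_sum_shifts[OF j]
    by (simp add: path_eigenfunction_def step_a_step_a step_v_step_v[OF N(1) j] algebra_simps)
qed

end

text \<open>At a bad value of \<open>\<theta>\<close> the operator \<open>O + \<mu>\<close> might annihilate the wave.  A zero at the start of the path
  would force \<open>\<mu> = -1 - 2 cos \<theta>\<close>, and with \<open>\<mu>\<^sup>2 = 1 + 8 cos\<^sup>2 \<theta>\<close> this leaves only \<open>cos \<theta> = 0\<close> and
  \<open>cos \<theta> = 1\<close>.\<close>

lemma path_eigenfunction_nonzero:
  assumes "\<mu>\<^sup>2 = 1 + 8 * (cos \<theta>)\<^sup>2" "0 < \<theta>" "\<theta> < pi / 2"
  shows "path_eigenfunction N \<theta> \<mu> 0 \<noteq> 0"
proof
  define x where "x = \<theta> / 2"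
  have x: "\<theta> = 2 * x" by (simp add: x_def)
  have cx: "cos x > 0" using assms by (intro cos_gt_zero) (auto simp: x_def)
  assume "path_eigenfunction N \<theta> \<mu> 0 = 0"
  then have "cos (3 * x) + (2 + \<mu>) * cos x = 0"
    by (simp add: path_eigenfunction_def wave_def step_a_def step_v_def x algebra_simps)
  moreover have "cos (3 * x) = 4 * cos x ^ 3 - 3 * cos x" by (rule cos_treble_cos)
  ultimately have "cos x * (4 * (cos x)\<^sup>2 - 1 + \<mu>) = 0"
    by (simp add: algebra_simps power2_eq_square power3_eq_cube)
  then have \<mu>: "\<mu> = - 1 - 2 * cos \<theta>"
    using cx by (simp add: x cos_double_cos)
  have "(- 1 - 2 * cos \<theta>)\<^sup>2 = 1 + 8 * (cos \<theta>)\<^sup>2"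
    using assms(1) unfolding \<mu> .
  then have "cos \<theta> * (cos \<theta> - 1) = 0" by (simp add: power2_eq_square algebra_simps)
  moreover have "cos \<theta> > 0" using assms by (intro cos_gt_zero) auto
  moreover have "cos \<theta> < cos 0" using assms pi_gt_zero by (intro cos_monotone_0_pi) linarith+
  ultimately show False by simp
qed

section \<open>Distances of product vectors\<close>

text \<open>Two product vectors with unit factors are at squared distance \<open>2 - 2 \<Prod> \<langle>x\<^sub>u, y\<^sub>u\<rangle>\<close>, since the inner
  product of product vectors is the product of the inner products.  Bernoulli's inequality then turns a bound
  on the factors into one on the vectors.\<close>

lemma sum_PiE_prod_diff_square:
  fixes x y :: "'u \<Rightarrow> 'k \<Rightarrow> real" and \<delta> :: real
  assumes fin: "finite L" "finite C"
    and x: "\<And>u. u \<in> L \<Longrightarrow> (\<Sum>k\<in>C. x u k * x u k) = 1"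
    and y: "\<And>u. u \<in> L \<Longrightarrow> (\<Sum>k\<in>C. y u k * y u k) = 1"
    and xy: "\<And>u. u \<in> L \<Longrightarrow> 1 - \<delta> \<le> (\<Sum>k\<in>C. x u k * y u k)"
    and \<delta>: "\<delta> \<le> 1"
  shows "(\<Sum>\<kappa>\<in>L \<rightarrow>\<^sub>E C. ((\<Prod>u\<in>L. x u (\<kappa> u)) - (\<Prod>u\<in>L. y u (\<kappa> u)))\<^sup>2) \<le> 2 * card L * \<delta>"
proof -
  have inner: "(\<Sum>\<kappa>\<in>L \<rightarrow>\<^sub>E C. (\<Prod>u\<in>L. p u (\<kappa> u)) * (\<Prod>u\<in>L. q u (\<kappa> u))) = (\<Prod>u\<in>L. \<Sum>k\<in>C. p u k * q u k)"
    for p q :: "'u \<Rightarrow> 'k \<Rightarrow> real"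
    using prod_sum_PiE[of L "\<lambda>_. C" "\<lambda>u k. p u k * q u k"] fin by (simp add: prod.distrib)
  have "(\<Sum>\<kappa>\<in>L \<rightarrow>\<^sub>E C. ((\<Prod>u\<in>L. x u (\<kappa> u)) - (\<Prod>u\<in>L. y u (\<kappa> u)))\<^sup>2)
    = (\<Prod>u\<in>L. \<Sum>k\<in>C. x u k * x u k) + (\<Prod>u\<in>L. \<Sum>k\<in>C. y u k * y u k)
      - 2 * (\<Prod>u\<in>L. \<Sum>k\<in>C. x u k * y u k)"
    unfolding inner[symmetric]
    by (simp add: power2_eq_square algebra_simps sum.distrib sum_subtractf sum_distrib_left)
  also have "\<dots> = 2 - 2 * (\<Prod>u\<in>L. \<Sum>k\<in>C. x u k * y u k)"
    using x y by simp
  also have "\<dots> \<le> 2 - 2 * (\<Prod>u\<in>L. 1 - \<delta>)"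
    using prod_mono[of L "\<lambda>_. 1 - \<delta>" "\<lambda>u. \<Sum>k\<in>C. x u k * y u k"] xy \<delta> by simp
  also have "\<dots> \<le> 2 - 2 * (1 - card L * \<delta>)"
    using Bernoulli_inequality[of "- \<delta>" "card L"] \<delta> by simp
  finally show ?thesis by simp
qed

lemma one_minus_square_le_cos: "1 - x\<^sup>2 / 2 \<le> cos (x::real)"
proof -
  have "(sin (x / 2))\<^sup>2 \<le> (x / 2)\<^sup>2"
    using abs_sin_x_le_abs_x[of "x / 2"] by (rule abs_le_square_iff[THEN iffD1])
  then show ?thesis using cos_double_sin[of "x / 2"] by (simp add: power_divide)
qed

section \<open>Sections at a level\<close>

definition words :: "nat \<Rightarrow> vertex set" where
  "words n = {w. length w = n}"

lemma finite_words: "finite (words n)" and card_words: "card (words n) = 2 ^ n"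
  using finite_lists_length_eq[of "UNIV :: bool set" n] card_lists_length_eq[of "UNIV :: bool set" n]
  by (simp_all add: words_def)

text \<open>Maps that split into an action on level \<open>n\<close> and sections below it.  Surjectivity makes the left
  composition with group elements free.\<close>

definition tree_like :: "nat \<Rightarrow> (vertex \<Rightarrow> vertex) set" where
  "tree_like n = {h. surj h \<and> (\<forall>u. length (h u) = length u) \<and>
     (\<forall>u v. length u = n \<longrightarrow> take n (h (u @ v)) = h u)}"

definition section_at :: "nat \<Rightarrow> (vertex \<Rightarrow> vertex) \<Rightarrow> vertex \<Rightarrow> vertex \<Rightarrow> vertex" where
  "section_at n h u v = drop n (h (u @ v))"

text \<open>These represent the possible actions on the words of length at most \<open>n\<close>; there are finitely many.\<close>

definition finitary :: "nat \<Rightarrow> (vertex \<Rightarrow> vertex) set" where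
  "finitary n = {p. surj p \<and> (\<forall>u. length (p u) = length u) \<and>
     (\<forall>u v. length u = n \<longrightarrow> p (u @ v) = p u @ v)}"

definition glue :: "nat \<Rightarrow> (vertex \<Rightarrow> vertex) \<Rightarrow> (vertex \<Rightarrow> vertex \<Rightarrow> vertex) \<Rightarrow> vertex \<Rightarrow> vertex" where
  "glue n p \<kappa> u = (if length u < n then p u else p (take n u) @ \<kappa> (take n u) (drop n u))"

lemma tree_like_split:
  assumes "h \<in> tree_like n" "length u = n"
  shows "h (u @ v) = h u @ section_at n h u v"
  using assms append_take_drop_id[of n "h (u @ v)"] by (simp add: tree_like_def section_at_def)

lemma finite_finitary: "finite (finitary n)"
proof (rule finite_imageD)
  let ?S = "{u::vertex. length u \<le> n}"
  have fin: "finite ?S" using finite_lists_length_le[of "UNIV :: bool set" n] by simp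
  have "(\<lambda>p. restrict p ?S) ` finitary n \<subseteq> ?S \<rightarrow>\<^sub>E ?S"
    by (auto simp: finitary_def split: if_splits)
  then show "finite ((\<lambda>p. restrict p ?S) ` finitary n)"
    using finite_PiE[OF fin fin] finite_subset by blast
  show "inj_on (\<lambda>p. restrict p ?S) (finitary n)"
  proof (rule inj_onI, rule ext)
    fix p p' u assume p: "p \<in> finitary n" "p' \<in> finitary n" and eq: "restrict p ?S = restrict p' ?S"
    have eq': "p w = p' w" if "length w \<le> n" for w
      using fun_cong[OF eq, of w] that by simp
    show "p u = p' u"
    proof (cases "length u \<le> n")
      case False
      then have "p (take n u @ drop n u) = p' (take n u @ drop n u)"
        using p eq'[of "take n u"] unfolding finitary_def by (simp del: append_take_drop_id)
      then show ?thesis by simp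
    qed (rule eq')
  qed
qed

text \<open>Composition with \<open>s\<close>, cut off below level \<open>n\<close>, permutes the finitary maps.\<close>

lemma sum_finitary_shift:
  fixes \<phi> :: "vertex \<Rightarrow> real"
  assumes inv: "\<And>u. s (s u) = u" and len: "\<And>u. length (s u) = length u" and u: "length u = n"
  shows "(\<Sum>p\<in>finitary n. \<phi> (s (p u))) = (\<Sum>p\<in>finitary n. \<phi> (p u))"
proof -
  define s' where "s' w = s (take n w) @ drop n w" for w
  have s': "s' (s' w) = w" for w
  proof (cases "length w \<ge> n")
    case True
    then show ?thesis using len[of "take n w"] inv by (simp add: s'_def)
  next
    case False
    then show ?thesis using len[of w] inv by (simp add: s'_def)
  qed
  then have s'_comp: "s' \<circ> (s' \<circ> p) = p" for p :: "vertex \<Rightarrow> vertex" by (simp add: fun_eq_iff)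
  have len': "length (s' w) = length w" for w using len by (simp add: s'_def)
  have closed: "s' \<circ> p \<in> finitary n" if "p \<in> finitary n" for p
  proof -
    have "surj s'" using s' by (metis surj_def)
    then have "surj (s' \<circ> p)" using that by (intro comp_surj) (auto simp: finitary_def)
    then show ?thesis using that len' by (simp add: finitary_def) (simp add: s'_def)
  qed
  have "(\<Sum>p\<in>finitary n. \<phi> (s (p u))) = (\<Sum>p\<in>finitary n. \<phi> ((s' \<circ> p) u))"
    using u by (intro sum.cong) (auto simp: s'_def finitary_def)
  also have "\<dots> = (\<Sum>p\<in>finitary n. \<phi> (p u))"
    by (rule sum.reindex_bij_witness[where i = "\<lambda>p. s' \<circ> p" and j = "\<lambda>p. s' \<circ> p"])
      (simp_all only: closed s'_comp)
  finally show ?thesis .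
qed

text \<open>The interpolation between the two ends of the path is linear, so that a step along the path changes the
  angle by the same small amount everywhere.\<close>

definition angle :: "nat \<Rightarrow> nat \<Rightarrow> real" where
  "angle n j = pi / 3 * (1 - real j / (2 ^ n - 1))"

text \<open>For each action on level \<open>n\<close> this bounds the squared distance by which a generator moves the weight
  that is defined below.\<close>

definition energy_bound :: "nat \<Rightarrow> real" where
  "energy_bound n = 2 ^ n * (pi / 3 / (2 ^ n - 1))\<^sup>2"

text \<open>Three sequences as in the columns of the definition of the groups: exactly two of the three are
  true at each index, and each is true infinitely often.\<close>

locale two_of_three =
  fixes eb ec ed :: "nat \<Rightarrow> bool"
  assumes two: "ed i \<longleftrightarrow> eb i \<noteq> ec i" "eb i \<or> ec i"
    and infinitely_often: "\<exists>i\<ge>n. eb i" "\<exists>i\<ge>n. ec i" "\<exists>i\<ge>n. ed i"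
begin

definition generators :: "(vertex \<Rightarrow> vertex) set" where
  "generators = {flip, directed eb, directed ec, directed ed}"

definition tails :: "nat \<Rightarrow> (nat \<Rightarrow> bool) set" where
  "tails n = {\<lambda>_. False, \<lambda>i. eb (i + n), \<lambda>i. ec (i + n), \<lambda>i. ed (i + n)}"

text \<open>The sections that carry weight: an element of the four-group formed by the sections of \<open>b, c, d\<close> at the
  start of the path, composed with a power of \<open>flip\<close> on its right.  The left factor absorbs the sections met at the start of the
  path, and the two powers of \<open>flip\<close> absorb those met at its end.\<close>

definition local_maps :: "nat \<Rightarrow> (vertex \<Rightarrow> vertex) set" where
  "local_maps n = (\<lambda>(e, x). directed e \<circ> (if x then flip else id)) ` (tails n \<times> UNIV)"

text \<open>At each angle \<open>t\<close> this is the unit vector \<open>cos t x + sin t y\<close>, where \<open>x\<close> is uniform on the powers of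
  \<open>flip\<close> and \<open>y\<close> is uniform on the six other local maps.  At \<open>t = \<pi>/3\<close> all eight values are equal.\<close>

definition amplitude :: "nat \<Rightarrow> real \<Rightarrow> (vertex \<Rightarrow> vertex) \<Rightarrow> real" where
  "amplitude n t k = (if k \<in> {id, flip} then cos t / sqrt 2
     else if k \<in> local_maps n then sin t / sqrt 6 else 0)"

text \<open>Here it matters that each sequence is true infinitely often: otherwise two of these sections
  would coincide at deep levels.\<close>

lemma card_tails: "card (tails n) = 4"
proof -
  obtain i j k where "eb (i + n)" "ec (j + n)" "ed (k + n)"
    using infinitely_often[of n] by (metis le_iff_add add.commute)
  then have "(\<lambda>i. eb (i + n)) \<noteq> (\<lambda>_. False)" "(\<lambda>i. ec (i + n)) \<noteq> (\<lambda>_. False)"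
      "(\<lambda>i. ed (i + n)) \<noteq> (\<lambda>_. False)" "(\<lambda>i. eb (i + n)) \<noteq> (\<lambda>i. ec (i + n))"
      "(\<lambda>i. eb (i + n)) \<noteq> (\<lambda>i. ed (i + n))" "(\<lambda>i. ec (i + n)) \<noteq> (\<lambda>i. ed (i + n))"
    using two by metis+
  moreover have "card {p, q, r, s} = 4" if "q \<noteq> p" "r \<noteq> p" "s \<noteq> p" "q \<noteq> r" "q \<noteq> s" "r \<noteq> s"
    for p q r s :: "nat \<Rightarrow> bool" using that by auto
  ultimately show ?thesis unfolding tails_def by blast
qed

lemma tails_xor: "e \<in> tails n \<Longrightarrow> e' \<in> tails n \<Longrightarrow> (\<lambda>i. e i \<noteq> e' i) \<in> tails n"
proof -
  have xor: "(eb i = (\<not> ec i)) = ed i" "(ec i = (\<not> eb i)) = ed i" "(eb i = (\<not> ed i)) = ec i"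
    "(ed i = (\<not> eb i)) = ec i" "(ec i = (\<not> ed i)) = eb i" "(ed i = (\<not> ec i)) = eb i" for i
    using two by blast+
  have trivial: "(P \<noteq> P) = False" "(P \<noteq> False) = P" "(False \<noteq> P) = P" for P by simp_all
  assume "e \<in> tails n" "e' \<in> tails n"
  then show ?thesis
    unfolding tails_def by (elim insertE emptyE; hypsubst) (simp_all only: xor trivial insert_iff simp_thms)
qed

lemma card_local_maps: "card (local_maps n) = 8"
proof -
  have "inj_on (\<lambda>(e, x). directed e \<circ> (if x then flip else id)) (tails n \<times> UNIV)"
  proof (rule inj_onI, clarify)
    fix e e' :: "nat \<Rightarrow> bool" and x x'
    assume eq: "directed e \<circ> (if x then flip else id) = directed e' \<circ> (if x' then flip else id)"
    have "directed e [y] = [y]" for e y by (cases y) simp_all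
    then have "x = x'" using fun_cong[OF eq, of "[False]"] by (auto split: if_splits)
    moreover have "directed e w = directed e' w" for w
      using fun_cong[OF eq, of "(if x then flip else id) w"] \<open>x = x'\<close> by (auto split: if_splits)
    ultimately show "e = e' \<and> x = x'" using directed_inj by blast
  qed
  then show ?thesis by (simp add: local_maps_def card_image card_cartesian_product card_tails)
qed

lemma finite_local_maps: "finite (local_maps n)"
  using card_local_maps[of n] card.infinite by fastforce

lemma id_flip_local_maps: "{id, flip} \<subseteq> local_maps n"
proof -
  have "directed (\<lambda>_. False) = id" by (auto simp: directed_False)
  then have "(\<lambda>(e, x). directed e \<circ> (if x then flip else id)) (\<lambda>_. False, x) = (if x then flip else id)" for x
    by simp
  then show ?thesis unfolding local_maps_def tails_def by (metis (no_types, lifting) UNIV_I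
      empty_subsetI insertI1 insert_subset mem_Sigma_iff rev_image_eqI)
qed

lemma local_maps_props:
  assumes "k \<in> local_maps n"
  shows "surj k" "length (k v) = length v"
proof -
  have "surj (directed e)" for e
    by (rule surjI[of _ "directed e"]) (simp add: directed_directed directed_False)
  moreover have "surj flip" by (rule surjI[of _ flip]) simp
  then have "surj (if x then flip else id)" for x by simp
  moreover obtain e x where k: "k = directed e \<circ> (if x then flip else id)"
    using assms by (auto simp: local_maps_def)
  ultimately show "surj k" unfolding k by (intro comp_surj)
  show "length (k v) = length v" by (simp add: k)
qed

lemma directed_comp_local_maps:
  assumes "e \<in> tails n"
  shows "directed e \<circ> k \<in> local_maps n \<longleftrightarrow> k \<in> local_maps n"
proof -
  have 1: "directed e \<circ> k \<in> local_maps n" if k: "k \<in> local_maps n" for k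
  proof -
    obtain e' x where "e' \<in> tails n" "k = directed e' \<circ> (if x then flip else id)"
      using k by (auto simp: local_maps_def)
    then have "directed e \<circ> k = directed (\<lambda>i. e i \<noteq> e' i) \<circ> (if x then flip else id)"
      by (simp add: fun_eq_iff directed_directed)
    with tails_xor[OF assms \<open>e' \<in> tails n\<close>] show ?thesis
      unfolding local_maps_def
      by (intro image_eqI[where x = "(\<lambda>i. e i \<noteq> e' i, x)"])
        (simp_all only: prod.case mem_Sigma_iff UNIV_I simp_thms)
  qed
  have "directed e \<circ> (directed e \<circ> k) = k"
    by (simp add: fun_eq_iff directed_directed directed_False)
  then show ?thesis using 1[of k] 1[of "directed e \<circ> k"] by auto
qed

lemma amplitude_inner:
  "(\<Sum>k\<in>local_maps n. amplitude n t k * amplitude n t' k) = cos (t - t')"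
proof -
  have "(id :: vertex \<Rightarrow> vertex) \<noteq> flip"
  proof
    assume "id = flip"
    then have "id [False] = flip [False]" by metis
    then show False by simp
  qed
  then have card2: "card {id, flip} = 2" by simp
  have "(\<Sum>k\<in>local_maps n. amplitude n t k * amplitude n t' k) =
      (\<Sum>k\<in>{id, flip}. amplitude n t k * amplitude n t' k) +
      (\<Sum>k\<in>local_maps n - {id, flip}. amplitude n t k * amplitude n t' k)"
    using sum.subset_diff[OF id_flip_local_maps finite_local_maps] by (simp add: add.commute)
  also have "(\<Sum>k\<in>{id, flip}. amplitude n t k * amplitude n t' k)
      = (\<Sum>k\<in>{id, flip::vertex\<Rightarrow>vertex}. (cos t / sqrt 2) * (cos t' / sqrt 2))"
    by (intro sum.cong) (auto simp: amplitude_def)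
  also have "\<dots> = cos t * cos t'"
    unfolding sum_constant card2 by simp
  also have "(\<Sum>k\<in>local_maps n - {id, flip}. amplitude n t k * amplitude n t' k)
      = (\<Sum>k\<in>local_maps n - {id, flip}. (sin t / sqrt 6) * (sin t' / sqrt 6))"
    by (intro sum.cong) (auto simp: amplitude_def)
  also have "\<dots> = sin t * sin t'"
    unfolding sum_constant
    by (subst card_Diff_subset) (use id_flip_local_maps in \<open>simp_all add: card2 card_local_maps\<close>)
  finally show ?thesis by (simp add: cos_diff)
qed

lemma generators_involution:
  assumes "s \<in> generators"
  shows "s (s u) = u" "length (s u) = length u"
  using assms by (auto simp: generators_def directed_directed directed_False)

lemma pos_generator_diff:
  assumes "s \<in> generators" "w \<noteq> []"
  shows "\<bar>real (pos (s w)) - real (pos w)\<bar> \<le> 1"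
  using assms
  by (auto simp: generators_def pos_flip pos_directed step_a_def step_v_def of_nat_diff)

text \<open>The angles at the two ends of the path are chosen such that the amplitude is invariant under the
  sections that the generators have there: at the angle \<open>\<pi>/3\<close> it is constant on the local maps, and at
  the angle \<open>0\<close> it is concentrated on the two powers of \<open>flip\<close>.\<close>

lemma generator_section:
  assumes s: "s \<in> generators" and w: "length w = n" and n: "n \<ge> 1"
  shows "\<exists>g. (\<forall>v. s (w @ v) = s w @ g v) \<and>
    (\<forall>k. amplitude n (angle n (pos (s w))) (g \<circ> k) = amplitude n (angle n (pos (s w))) k)"
proof (cases "s = flip")
  case True
  then show ?thesis using w n by (cases w) (auto intro!: exI[of _ id])
next
  case False
  then obtain e where e: "s = directed e" "(\<lambda>i. e (i + n)) \<in> tails n"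
    using s by (auto simp: generators_def tails_def)
  consider "pos w = 0" | "pos w = 2 ^ n - 1" | "pos w \<noteq> 0" "pos w \<noteq> 2 ^ n - 1" by blast
  then show ?thesis
  proof cases
    case 1
    then have "pos (s w) = 0" by (simp add: e pos_directed step_v_def)
    then have angle: "angle n (pos (s w)) = pi / 3" by (simp add: angle_def)
    have "sin (pi / 3) / sqrt 6 = cos (pi / 3) / sqrt (2::real)"
      by (simp add: sin_60 cos_60 real_sqrt_mult[of 3 2, simplified])
    then have "amplitude n (pi / 3) k = (if k \<in> local_maps n then cos (pi / 3) / sqrt 2 else 0)" for k
      using id_flip_local_maps[of n] unfolding amplitude_def by auto
    then have "amplitude n (angle n (pos (s w))) (directed (\<lambda>i. e (i + n)) \<circ> k) = amplitude n (angle n (pos (s w))) k" for k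
      unfolding angle using directed_comp_local_maps[OF e(2)] by simp
    then show ?thesis
      using directed_append(1)[OF 1, of e] w e(1) by blast
  next
    case 2
    then have "pos (s w) = 2 ^ n - 1" using w by (simp add: e pos_directed step_v_def)
    moreover have "(2::real) ^ n \<noteq> 1" using power_increasing[OF n, of "2::real"] by auto
    ultimately have "angle n (pos (s w)) = 0" by (simp add: angle_def of_nat_diff)
    moreover have "amplitude n 0 k = (if k \<in> {id, flip} then 1 / sqrt 2 else 0)" for k
      by (simp add: amplitude_def)
    moreover have "flip \<circ> k \<in> {id, flip} \<longleftrightarrow> k \<in> {id, flip}" for k
      by (auto simp: fun_eq_iff) (metis flip_flip)+
    moreover have "w \<noteq> []" using w n by auto
    from directed_append(2)[OF this, of e] 2 w
    have "directed e (w @ v) = directed e w @ (if e (n - 1) then flip v else v)" for v by simp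
    ultimately show ?thesis
      using e(1)
      by (intro exI[of _ "if e (n - 1) then flip else id"]) auto
  next
    case 3
    then show ?thesis using directed_append(3)[of w e] w e(1) by (intro exI[of _ id]) simp
  qed
qed

lemma generator_comp_tree_like:
  assumes s: "s \<in> generators" and n: "n \<ge> 1"
  shows "s \<circ> h \<in> tree_like n \<longleftrightarrow> h \<in> tree_like n"
proof -
  have "surj s" using generators_involution[OF s] by (metis surj_def)
  have 1: "s \<circ> h \<in> tree_like n" if h: "h \<in> tree_like n" for h
  proof -
    have "take n (s (h (u @ v))) = s (h u)" if u: "length u = n" for u v
    proof -
      have hu: "length (h u) = n" using h u by (simp add: tree_like_def)
      obtain g where "\<And>v. s (h u @ v) = s (h u) @ g v"
        using generator_section[OF s hu n] by blast
      then show ?thesis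
        using tree_like_split[OF h u] generators_involution(2)[OF s] hu by simp
    qed
    moreover have "surj (s \<circ> h)" using h \<open>surj s\<close> by (intro comp_surj) (auto simp: tree_like_def)
    ultimately show ?thesis using h generators_involution[OF s]
      by (simp add: tree_like_def)
  qed
  have "s \<circ> (s \<circ> h) = h" using generators_involution[OF s] by (simp add: fun_eq_iff)
  then show ?thesis using 1[of h] 1[of "s \<circ> h"] by auto
qed

section \<open>The product vector of a level\<close>

text \<open>Positions and sections are taken from
  two separate maps because composing with a generator changes the weight through the positions only.\<close>

definition weight :: "nat \<Rightarrow> (vertex \<Rightarrow> vertex) \<Rightarrow> (vertex \<Rightarrow> vertex) \<Rightarrow> real" where
  "weight n p h = (\<Prod>u\<in>words n. amplitude n (angle n (pos (p u))) (section_at n h u))"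

definition weight_support :: "nat \<Rightarrow> (vertex \<Rightarrow> vertex) set" where
  "weight_support n = {h \<in> tree_like n. \<forall>u\<in>words n. section_at n h u \<in> local_maps n}"

text \<open>A section of the generator occurs only at an end of the path, and there the amplitude ignores it.\<close>

lemma weight_generator:
  assumes s: "s \<in> generators" and n: "n \<ge> 1" and h: "h \<in> tree_like n"
  shows "weight n (s \<circ> h) (s \<circ> h) = weight n (s \<circ> h) h"
  unfolding weight_def
proof (rule prod.cong[OF refl])
  fix u assume u: "u \<in> words n"
  then have hu: "length (h u) = n" using h by (simp add: tree_like_def words_def)
  obtain g where g: "\<And>v. s (h u @ v) = s (h u) @ g v"
    "\<And>k. amplitude n (angle n (pos (s (h u)))) (g \<circ> k) = amplitude n (angle n (pos (s (h u)))) k"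
    using generator_section[OF s hu n] by blast
  have "section_at n (s \<circ> h) u = g \<circ> section_at n h u"
    using u hu tree_like_split[OF h] generators_involution(2)[OF s] g(1)
    by (simp add: fun_eq_iff section_at_def[of n "s \<circ> h"] words_def)
  then show "amplitude n (angle n (pos ((s \<circ> h) u))) (section_at n (s \<circ> h) u) =
    amplitude n (angle n (pos ((s \<circ> h) u))) (section_at n h u)"
    by (simp add: g(2))
qed

lemma weight_outside:
  assumes "h \<in> tree_like n" "h \<notin> weight_support n"
  shows "weight n p h = 0"
proof -
  obtain u where "u \<in> words n" "section_at n h u \<notin> local_maps n"
    using assms by (auto simp: weight_support_def)
  then show ?thesis
    unfolding weight_def using id_flip_local_maps
    by (intro prod_zero finite_words bexI[of _ u]) (auto simp: amplitude_def)
qed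

lemma weight_id_pos:
  assumes "n \<ge> 1"
  shows "weight n id id > 0"
  unfolding weight_def
proof (rule prod_pos)
  fix u assume u: "u \<in> words n"
  have "section_at n id u = id" using u by (simp add: section_at_def fun_eq_iff words_def)
  moreover have "real (pos u) \<le> 2 ^ n - 1"
    using pos_less[of u] u by (simp add: words_def) (metis Suc_leI le_diff_conv2 of_nat_Suc of_nat_le_iff of_nat_numeral of_nat_power le_diff_eq add.commute plus_1_eq_Suc)
  moreover have "(2::real) ^ n > 1" using assms by simp
  ultimately have "0 \<le> angle n (pos u)" "angle n (pos u) \<le> pi / 3"
    by (simp_all add: angle_def divide_simps)
  then have "cos (angle n (pos u)) > 0" using pi_gt_zero by (intro cos_gt_zero_pi) linarith+
  then show "0 < amplitude n (angle n (pos (id u))) (section_at n id u)"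
    using \<open>section_at n id u = id\<close> by (simp add: amplitude_def)
qed

lemma glue_facts:
  assumes p: "p \<in> finitary n" and \<kappa>: "\<kappa> \<in> words n \<rightarrow>\<^sub>E local_maps n"
  shows "glue n p \<kappa> \<in> weight_support n"
    and "\<And>u. length u \<le> n \<Longrightarrow> glue n p \<kappa> u = p u"
    and "\<And>u. u \<in> words n \<Longrightarrow> section_at n (glue n p \<kappa>) u = \<kappa> u"
proof -
  have p': "surj p" "\<And>u. length (p u) = length u" using p by (auto simp: finitary_def)
  have \<kappa>': "surj (\<kappa> u)" "length (\<kappa> u v) = length v" if "length u = n" for u v
    using \<kappa> that local_maps_props[of "\<kappa> u" n] by (auto simp: words_def)
  show short: "glue n p \<kappa> u = p u" if "length u \<le> n" for u
    using that \<kappa>'(2)[of u "[]"] by (cases "length u = n") (simp_all add: glue_def)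
  have long: "glue n p \<kappa> (u @ v) = p u @ \<kappa> u v" if "length u = n" for u v
    using that by (simp add: glue_def)
  show sec: "section_at n (glue n p \<kappa>) u = \<kappa> u" if "u \<in> words n" for u
    using that p' by (simp add: section_at_def fun_eq_iff words_def long)
  have len: "length (glue n p \<kappa> u) = length u" for u
    using p' \<kappa>' by (auto simp: glue_def)
  have "\<exists>u. glue n p \<kappa> u = w" for w
  proof (cases "length w < n")
    case True
    obtain u where "p u = w" using p'(1) by (metis surj_def)
    then show ?thesis using short[of u] p'(2)[of u] True by auto
  next
    case False
    obtain u where u: "p u = take n w" using p'(1) by (metis surj_def)
    then have lu: "length u = n" using p'(2)[of u] False by simp
    obtain v where "\<kappa> u v = drop n w" using \<kappa>'(1)[OF lu] by (metis surj_def)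
    then have "glue n p \<kappa> (u @ v) = w" using long[OF lu] u by simp
    then show ?thesis by blast
  qed
  then have "surj (glue n p \<kappa>)" by (metis surj_def)
  then have "glue n p \<kappa> \<in> tree_like n"
    using len long short p'(2) by (simp add: tree_like_def)
  then show "glue n p \<kappa> \<in> weight_support n"
    using sec \<kappa> by (auto simp: weight_support_def)
qed

text \<open>A map in the support is determined by its action on level \<open>n\<close> and its sections there, and these can be
  chosen independently.  This makes the weight a product vector for each fixed action.\<close>

lemma bij_betw_glue:
  "bij_betw (\<lambda>(p, \<kappa>). glue n p \<kappa>) (finitary n \<times> (words n \<rightarrow>\<^sub>E local_maps n)) (weight_support n)"
proof (rule bij_betw_imageI)
  show "inj_on (\<lambda>(p, \<kappa>). glue n p \<kappa>) (finitary n \<times> (words n \<rightarrow>\<^sub>E local_maps n))"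
  proof (rule inj_onI, clarify)
    fix p \<kappa> p' \<kappa>'
    assume m: "p \<in> finitary n" "\<kappa> \<in> words n \<rightarrow>\<^sub>E local_maps n" "p' \<in> finitary n" "\<kappa>' \<in> words n \<rightarrow>\<^sub>E local_maps n"
      and eq: "glue n p \<kappa> = glue n p' \<kappa>'"
    have short: "p u = p' u" if "length u \<le> n" for u
      using glue_facts(2)[OF m(1,2) that] glue_facts(2)[OF m(3,4) that] eq by simp
    have "p u = p' u" for u
    proof (cases "length u \<le> n")
      case False
      then have "p (take n u @ drop n u) = p' (take n u @ drop n u)"
        using m short[of "take n u"] unfolding finitary_def by (simp del: append_take_drop_id)
      then show ?thesis by simp
    qed (rule short)
    moreover have "\<kappa> u = \<kappa>' u" if "u \<in> words n" for u
      using glue_facts(3)[OF m(1,2) that] glue_facts(3)[OF m(3,4) that] eq by simp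
    then have "\<kappa> = \<kappa>'" using PiE_ext[OF m(2) m(4)] by blast
    ultimately show "p = p' \<and> \<kappa> = \<kappa>'" by blast
  qed
  show "(\<lambda>(p, \<kappa>). glue n p \<kappa>) ` (finitary n \<times> (words n \<rightarrow>\<^sub>E local_maps n)) = weight_support n"
  proof
    show "(\<lambda>(p, \<kappa>). glue n p \<kappa>) ` (finitary n \<times> (words n \<rightarrow>\<^sub>E local_maps n)) \<subseteq> weight_support n"
      using glue_facts(1) by auto
    show "weight_support n \<subseteq> (\<lambda>(p, \<kappa>). glue n p \<kappa>) ` (finitary n \<times> (words n \<rightarrow>\<^sub>E local_maps n))"
    proof
      fix h assume h: "h \<in> weight_support n"
      then have ht: "h \<in> tree_like n" by (simp add: weight_support_def)
      then have h': "surj h" "\<And>u. length (h u) = length u" by (auto simp: tree_like_def)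
      define p where "p w = h (take n w) @ drop n w" for w
      define \<kappa> where "\<kappa> = restrict (section_at n h) (words n)"
      have "\<exists>u. p u = w" for w
      proof -
        obtain u where u: "h u = take n w" using h'(1) by (metis surj_def)
        then have lu: "length u = min (length w) n" using h'(2)[of u] by simp
        then have "p (u @ drop n w) = w"
          by (cases "length w \<le> n") (simp_all add: p_def u)
        then show ?thesis by blast
      qed
      then have "p \<in> finitary n"
        using h' by (auto simp: finitary_def p_def surj_def) metis
      moreover have "\<kappa> \<in> words n \<rightarrow>\<^sub>E local_maps n"
        using h by (auto simp: \<kappa>_def weight_support_def)
      moreover have "glue n p \<kappa> = h"
      proof
        fix u
        show "glue n p \<kappa> u = h u"
          using tree_like_split[OF ht, of "take n u" "drop n u"]
          by (cases "length u < n") (simp_all add: glue_def p_def \<kappa>_def words_def)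
      qed
      ultimately show "h \<in> (\<lambda>(p, \<kappa>). glue n p \<kappa>) ` (finitary n \<times> (words n \<rightarrow>\<^sub>E local_maps n))"
        by force
    qed
  qed
qed

lemma finite_weight_support: "finite (weight_support n)"
  using bij_betw_finite[OF bij_betw_glue[of n]]
  by (simp add: finite_finitary finite_words finite_local_maps finite_PiE)

lemma sum_weight_support:
  "(\<Sum>h\<in>weight_support n. \<Phi> h) =
    (\<Sum>p\<in>finitary n. \<Sum>\<kappa>\<in>words n \<rightarrow>\<^sub>E local_maps n. \<Phi> (glue n p \<kappa>))"
  unfolding sum.cartesian_product sum.reindex_bij_betw[OF bij_betw_glue, symmetric]
  by (simp add: case_prod_unfold)

lemma weight_glue:
  assumes "p \<in> finitary n" "\<kappa> \<in> words n \<rightarrow>\<^sub>E local_maps n"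
  shows "weight n (s \<circ> glue n p \<kappa>) (glue n p \<kappa>)
    = (\<Prod>u\<in>words n. amplitude n (angle n (pos (s (p u)))) (\<kappa> u))"
  unfolding weight_def
  by (intro prod.cong refl) (use glue_facts[OF assms] in \<open>simp add: words_def\<close>)

text \<open>A generator moves each word by at most one step along the path, so it turns each of the \<open>2\<^sup>n\<close> factors of
  the weight by an angle of at most \<open>\<pi> / (3 (2\<^sup>n - 1))\<close>.  The resulting squared distance is a sum of \<open>2\<^sup>n\<close>
  squares of this size, which tends to \<open>0\<close>.  The factor \<open>F\<close> depends on the action on level \<open>n\<close> only, and a
  generator merely permutes these actions.\<close>

lemma weight_energy:
  fixes F :: "vertex \<Rightarrow> real"
  assumes s: "s \<in> generators" and n: "n \<ge> 2" and x: "length x = n"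
  shows "(\<Sum>h\<in>weight_support n. (F (s (h x)))\<^sup>2 * (weight n (s \<circ> h) h - weight n h h)\<^sup>2)
    \<le> energy_bound n * (\<Sum>h\<in>weight_support n. (F (h x) * weight n h h)\<^sup>2)"
proof -
  define \<delta> where "\<delta> = pi / 3 / (2 ^ n - 1)"
  let ?K = "words n \<rightarrow>\<^sub>E local_maps n"
  let ?W = "\<lambda>s p \<kappa>. \<Prod>u\<in>words n. amplitude n (angle n (pos (s (p u)))) (\<kappa> u)"
  have N: "(2::real) ^ n - 1 \<ge> 3" using power_increasing[OF n, of "2::real"] by simp
  have "pi / 3 \<le> 4 / 3" using pi_less_4 by simp
  also have "\<dots> \<le> 1 * (2 ^ n - 1)" using N by simp
  finally have \<delta>1: "0 \<le> \<delta>" "\<delta> \<le> 1" using N by (simp_all add: \<delta>_def divide_le_eq)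
  have "\<delta>\<^sup>2 / 2 \<le> 1" using power_le_one[OF \<delta>1, of 2] by simp
  have unit: "(\<Sum>\<kappa>\<in>?K. (?W id p \<kappa>)\<^sup>2) = 1" for p
    using prod_sum_PiE[of "words n" "\<lambda>_. local_maps n" "\<lambda>u k. amplitude n (angle n (pos (p u))) k * amplitude n (angle n (pos (p u))) k"]
    by (simp add: finite_words finite_local_maps amplitude_inner power2_eq_square prod.distrib)
  have diff: "(\<Sum>\<kappa>\<in>?K. (?W s p \<kappa> - ?W id p \<kappa>)\<^sup>2) \<le> energy_bound n" if p: "p \<in> finitary n" for p
  proof -
    have "1 - \<delta>\<^sup>2 / 2 \<le> (\<Sum>k\<in>local_maps n. amplitude n (angle n (pos (s (p u)))) k * amplitude n (angle n (pos (p u))) k)"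
      if u: "u \<in> words n" for u
    proof -
      have "length (p u) = n" using p u by (simp add: finitary_def words_def)
      then have "p u \<noteq> []" using n by auto
      have "angle n (pos (s (p u))) - angle n (pos (p u)) = \<delta> * (real (pos (p u)) - real (pos (s (p u))))"
        by (simp add: angle_def \<delta>_def algebra_simps diff_divide_distrib)
      then have "\<bar>angle n (pos (s (p u))) - angle n (pos (p u))\<bar> \<le> \<delta> * 1"
        using pos_generator_diff[OF s \<open>p u \<noteq> []\<close>] \<delta>1(1)
        by (simp only: abs_mult) (intro mult_mono, auto)
      then have "(angle n (pos (s (p u))) - angle n (pos (p u)))\<^sup>2 \<le> \<delta>\<^sup>2"
        using \<delta>1(1) by (simp add: abs_le_square_iff[symmetric])
      then show ?thesis
        using one_minus_square_le_cos[of "angle n (pos (s (p u))) - angle n (pos (p u))"]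
        by (simp add: amplitude_inner)
    qed
    then have "(\<Sum>\<kappa>\<in>?K. (?W s p \<kappa> - ?W id p \<kappa>)\<^sup>2) \<le> 2 * card (words n) * (\<delta>\<^sup>2 / 2)"
      using \<open>\<delta>\<^sup>2 / 2 \<le> 1\<close>
      by (intro sum_PiE_prod_diff_square finite_words finite_local_maps) (simp_all add: amplitude_inner)
    then show ?thesis by (simp add: card_words energy_bound_def \<delta>_def)
  qed
  have "(\<Sum>h\<in>weight_support n. (F (s (h x)))\<^sup>2 * (weight n (s \<circ> h) h - weight n h h)\<^sup>2)
    = (\<Sum>p\<in>finitary n. (F (s (p x)))\<^sup>2 * (\<Sum>\<kappa>\<in>?K. (?W s p \<kappa> - ?W id p \<kappa>)\<^sup>2))"
    unfolding sum_weight_support sum_distrib_left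
    using x by (intro sum.cong refl) (simp add: glue_facts(2) weight_glue weight_glue[where s = id, simplified])
  also have "\<dots> \<le> (\<Sum>p\<in>finitary n. (F (s (p x)))\<^sup>2 * energy_bound n)"
    by (intro sum_mono mult_left_mono diff) auto
  also have "\<dots> = energy_bound n * (\<Sum>p\<in>finitary n. (F (p x))\<^sup>2)"
    using sum_finitary_shift[of s x n "\<lambda>w. (F w)\<^sup>2"] generators_involution[OF s] x
    unfolding sum_distrib_right[symmetric] by (simp add: mult.commute)
  also have "(\<Sum>p\<in>finitary n. (F (p x))\<^sup>2) = (\<Sum>p\<in>finitary n. (F (p x))\<^sup>2 * (\<Sum>\<kappa>\<in>?K. (?W id p \<kappa>)\<^sup>2))"
    using unit by simp
  also have "\<dots> = (\<Sum>h\<in>weight_support n. (F (h x) * weight n h h)\<^sup>2)"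
    unfolding sum_weight_support sum_distrib_left
    using x by (intro sum.cong refl) (simp add: glue_facts(2) weight_glue[where s = id, simplified] power_mult_distrib)
  finally show ?thesis .
qed

end

section \<open>From functions of tree maps to functions on the group\<close>

text \<open>If the inequality failed on every class of positive weight, adding up would contradict the inequality
  for the whole set.\<close>

lemma exists_class_with_small_ratio:
  fixes r w :: "'h \<Rightarrow> real"
  assumes "finite D" and r: "\<And>h. h \<in> D \<Longrightarrow> 0 \<le> r h" and w: "\<And>h. h \<in> D \<Longrightarrow> 0 \<le> w h"
    and le: "sum r D \<le> E * sum w D" and pos: "0 < sum w D"
  shows "\<exists>y\<in>q ` D. 0 < sum w {h \<in> D. q h = y} \<and> sum r {h \<in> D. q h = y} \<le> E * sum w {h \<in> D. q h = y}"
proof (rule ccontr)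
  assume neg: "\<not> ?thesis"
  have group: "(\<Sum>y\<in>q ` D. sum v {h \<in> D. q h = y}) = sum v D" for v :: "'h \<Rightarrow> real"
    using \<open>finite D\<close> by (intro sum.group) auto
  have nonneg: "0 \<le> sum w {h \<in> D. q h = y}" "0 \<le> sum r {h \<in> D. q h = y}" for y
    using w r by (auto intro: sum_nonneg)
  have large: "E * sum w {h \<in> D. q h = y} < sum r {h \<in> D. q h = y}"
    if "y \<in> q ` D" "sum w {h \<in> D. q h = y} \<noteq> 0" for y
  proof -
    have "0 < sum w {h \<in> D. q h = y}" using that(2) nonneg(1)[of y] by linarith
    then show ?thesis using neg that(1) by (meson not_le)
  qed
  then have weak: "E * sum w {h \<in> D. q h = y} \<le> sum r {h \<in> D. q h = y}" if "y \<in> q ` D" for y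
    using that nonneg(2)[of y] by (cases "sum w {h \<in> D. q h = y} = 0") (simp_all add: less_imp_le)
  have "\<exists>y\<in>q ` D. sum w {h \<in> D. q h = y} \<noteq> 0"
  proof (rule ccontr)
    assume "\<not> ?thesis"
    then have "(\<Sum>y\<in>q ` D. sum w {h \<in> D. q h = y}) = 0" by (intro sum.neutral) simp
    then show False using group[of w] pos by simp
  qed
  then have "\<exists>y\<in>q ` D. E * sum w {h \<in> D. q h = y} < sum r {h \<in> D. q h = y}"
    using large by blast
  then have "(\<Sum>y\<in>q ` D. E * sum w {h \<in> D. q h = y}) < (\<Sum>y\<in>q ` D. sum r {h \<in> D. q h = y})"
    using \<open>finite D\<close> weak by (intro sum_strict_mono_ex1) simp_all
  then show False using le by (simp add: group sum_distrib_left[symmetric])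
qed

lemma ell2_finite_support:
  assumes F: "finite F" "F \<subseteq> X" and f: "\<And>x. x \<notin> F \<Longrightarrow> f x = 0"
  shows "f \<in> ell2 X" and "ell2_norm X f = sqrt (\<Sum>x\<in>F. (cmod (f x))\<^sup>2)"
proof -
  have "(\<lambda>x. (cmod (f x))\<^sup>2) summable_on X \<longleftrightarrow> (\<lambda>x. (cmod (f x))\<^sup>2) summable_on F"
    using assms by (intro summable_on_cong_neutral) auto
  then show "f \<in> ell2 X" using assms by (auto simp: ell2_def)
  have "(\<Sum>\<^sub>\<infinity>x\<in>X. (cmod (f x))\<^sup>2) = (\<Sum>\<^sub>\<infinity>x\<in>F. (cmod (f x))\<^sup>2)"
    using assms by (intro infsum_cong_neutral) auto
  then show "ell2_norm X f = sqrt (\<Sum>x\<in>F. (cmod (f x))\<^sup>2)"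
    using F by (simp add: ell2_norm_def)
qed

text \<open>Left composition with the elements of a group of maps is a free action on the surjective maps.
  So a finitely supported function on surjective maps splits into its restrictions to orbits, each of
  which is a copy of the group, and on one of them it is no worse an approximate eigenvector than as a
  whole.\<close>

lemma approximate_eigenvector_on_orbit:
  fixes G :: "('v \<Rightarrow> 'v, 'm) monoid_scheme" (structure) and \<Psi> :: "('v \<Rightarrow> 'v) \<Rightarrow> real"
  assumes "involution_and_klein_group G a b c d"
    and mult: "\<And>x y. x \<otimes> y = x \<circ> y" and one: "\<one> = id"
    and D: "finite D" "\<And>h. h \<in> D \<Longrightarrow> surj h"
    and R_def: "\<And>h. R h = (\<Sum>s\<in>{a, b, c, d}. \<Psi> (s \<circ> h)) / 4 - l * \<Psi> h"
    and supp: "\<And>h. h \<notin> D \<Longrightarrow> \<Psi> h = 0" "\<And>h. h \<notin> D \<Longrightarrow> R h = 0"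
    and le: "(\<Sum>h\<in>D. (R h)\<^sup>2) \<le> E * (\<Sum>h\<in>D. (\<Psi> h)\<^sup>2)" and pos: "0 < (\<Sum>h\<in>D. (\<Psi> h)\<^sup>2)"
  shows "\<exists>f\<in>ell2 (carrier G). f \<noteq> (\<lambda>_. 0) \<and>
    ell2_norm (carrier G) (\<lambda>g. markov G {a, b, c, d} f g - of_real l * f g) \<le> sqrt E * ell2_norm (carrier G) f"
proof -
  interpret involution_and_klein_group G a b c d by fact
  define q where "q h = (\<lambda>g. g \<circ> h) ` carrier G" for h :: "'v \<Rightarrow> 'v"
  obtain h0 where h0: "h0 \<in> D" "0 < (\<Sum>h | h \<in> D \<and> q h = q h0. (\<Psi> h)\<^sup>2)"
    "(\<Sum>h | h \<in> D \<and> q h = q h0. (R h)\<^sup>2) \<le> E * (\<Sum>h | h \<in> D \<and> q h = q h0. (\<Psi> h)\<^sup>2)"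
    using exists_class_with_small_ratio[OF D(1), of "\<lambda>h. (R h)\<^sup>2" "\<lambda>h. (\<Psi> h)\<^sup>2" E q, OF _ _ le pos]
    by auto
  define F where "F = {g \<in> carrier G. g \<circ> h0 \<in> D}"
  have cancel: "g = g'" if "g \<circ> h0 = g' \<circ> h0" for g g' :: "'v \<Rightarrow> 'v"
  proof
    fix x
    obtain y where "x = h0 y" using D(2)[OF h0(1)] by (metis surj_def)
    then show "g x = g' x" using fun_cong[OF that, of y] by simp
  qed
  have q: "q h = q h0 \<longleftrightarrow> (\<exists>g\<in>carrier G. h = g \<circ> h0)" for h
  proof
    have "h \<in> q h" unfolding q_def using one_closed one by (intro image_eqI[of _ _ id]) auto
    then show "\<exists>g\<in>carrier G. h = g \<circ> h0" if "q h = q h0" using that by (auto simp: q_def)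
  next
    assume "\<exists>g\<in>carrier G. h = g \<circ> h0"
    then obtain g where g: "g \<in> carrier G" "h = g \<circ> h0" by blast
    have "k \<circ> h \<in> q h0" if "k \<in> carrier G" for k
      using that g m_closed[OF that g(1)] mult unfolding q_def
      by (intro image_eqI[of _ _ "k \<circ> g"]) (simp_all add: comp_assoc)
    moreover have "k \<circ> h0 \<in> q h" if "k \<in> carrier G" for k
    proof -
      have "inv g \<circ> g = id" using g(1) l_inv[of g] by (simp add: mult one)
      then have "k \<circ> h0 = (k \<otimes> inv g) \<circ> h"
        using comp_assoc[of "inv g" g h0] g(2) by (simp add: mult comp_assoc)
      then show ?thesis using that g(1) unfolding q_def by (intro image_eqI[of _ _ "k \<otimes> inv g"]) simp_all
    qed
    ultimately show "q h = q h0" unfolding q_def by blast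
  qed
  have bij: "bij_betw (\<lambda>g. g \<circ> h0) F {h \<in> D. q h = q h0}"
    unfolding bij_betw_def F_def using cancel by (auto simp: q inj_on_def)
  have F: "finite F" "F \<subseteq> carrier G"
    using bij_betw_finite[OF bij] D(1) by (auto simp: F_def)
  define f where "f g = (if g \<in> carrier G then complex_of_real (\<Psi> (g \<circ> h0)) else 0)" for g
  have f0: "f g = 0" if "g \<notin> F" for g using that supp(1) by (auto simp: f_def F_def)
  have res: "markov G {a, b, c, d} f g - of_real l * f g
      = (if g \<in> carrier G then complex_of_real (R (g \<circ> h0)) else 0)" for g
  proof (cases "g \<in> carrier G")
    case True
    have "f (inv s \<otimes> g) = of_real (\<Psi> (s \<circ> (g \<circ> h0)))" if "s \<in> {a, b, c, d}" for s
    proof -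
      have s: "s \<in> carrier G" "inv s = s" using that in_carrier involutions inv_equality by auto
      show ?thesis using s True m_closed[OF s(1) True] by (simp add: f_def mult comp_assoc)
    qed
    then have "(\<Sum>s\<in>{a, b, c, d}. f (inv s \<otimes> g)) = of_real (\<Sum>s\<in>{a, b, c, d}. \<Psi> (s \<circ> (g \<circ> h0)))"
      unfolding of_real_sum by (rule sum.cong[OF refl])
    then show ?thesis unfolding markov_def card_gens R_def using True by (simp add: f_def)
  qed (simp add: markov_def f_def)
  then have res0: "markov G {a, b, c, d} f g - of_real l * f g = 0" if "g \<notin> F" for g
    using that supp(2) by (auto simp: F_def)
  have "ell2_norm (carrier G) f = sqrt (\<Sum>g\<in>F. (cmod (f g))\<^sup>2)"
    by (rule ell2_finite_support(2)[OF F f0])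
  also have "\<dots> = sqrt (\<Sum>h | h \<in> D \<and> q h = q h0. (\<Psi> h)\<^sup>2)"
    unfolding sum.reindex_bij_betw[OF bij, symmetric]
    using F(2) by (intro arg_cong[of _ _ sqrt] sum.cong) (auto simp: f_def)
  finally have norm_f: "ell2_norm (carrier G) f = sqrt (\<Sum>h | h \<in> D \<and> q h = q h0. (\<Psi> h)\<^sup>2)" .
  have "ell2_norm (carrier G) (\<lambda>g. markov G {a, b, c, d} f g - of_real l * f g)
      = sqrt (\<Sum>g\<in>F. (cmod (markov G {a, b, c, d} f g - of_real l * f g))\<^sup>2)"
    by (rule ell2_finite_support(2)[OF F res0])
  also have "\<dots> = sqrt (\<Sum>h | h \<in> D \<and> q h = q h0. (R h)\<^sup>2)"
    unfolding sum.reindex_bij_betw[OF bij, symmetric]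
    using F(2) by (intro arg_cong[of _ _ sqrt] sum.cong) (auto simp: res)
  also have "\<dots> \<le> sqrt E * ell2_norm (carrier G) f"
    unfolding norm_f real_sqrt_mult[symmetric] using h0(3) by simp
  finally have "ell2_norm (carrier G) (\<lambda>g. markov G {a, b, c, d} f g - of_real l * f g) \<le> sqrt E * ell2_norm (carrier G) f" .
  moreover have "f \<noteq> (\<lambda>_. 0)"
  proof
    assume "f = (\<lambda>_. 0)"
    then have "ell2_norm (carrier G) f = 0" by (simp add: ell2_norm_def)
    then show False using h0(2) norm_f by simp
  qed
  moreover have "f \<in> ell2 (carrier G)" by (rule ell2_finite_support(1)[OF F f0])
  ultimately show ?thesis by (intro bexI conjI)
qed

section \<open>Approximate eigenvectors\<close>

context two_of_three
begin

lemma card_generators: "card {flip, directed eb, directed ec, directed ed} = 4"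
proof -
  have eq: "(directed e = directed e') = (e = e')" for e e' using directed_inj by blast
  have "directed e [False] \<noteq> flip [False]" for e by simp
  then have "flip \<noteq> directed e" for e by metis
  moreover have "card (tails 0) = 4" by (rule card_tails)
  then have "eb \<noteq> ec" "eb \<noteq> ed" "ec \<noteq> ed"
    by (auto simp: tails_def card_insert_if split: if_splits)
  ultimately show ?thesis by (simp add: eq)
qed

text \<open>The base word \<open>1\<^sup>n\<close> has position \<open>0\<close>, where the eigenfunctions of the path do not vanish.\<close>

definition test_vector :: "nat \<Rightarrow> (nat \<Rightarrow> real) \<Rightarrow> (vertex \<Rightarrow> vertex) \<Rightarrow> real" where
  "test_vector n f h = (if h \<in> tree_like n then f (pos (h (replicate n True))) * weight n h h else 0)"

lemma sum_generators:
  fixes f :: "nat \<Rightarrow> real"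
  assumes "w \<noteq> []"
  shows "(\<Sum>s\<in>generators. f (pos (s w)))
    = f (step_a (pos w)) + 2 * f (step_v (2 ^ length w) (pos w)) + f (pos w)"
proof -
  have distinct: "flip \<notin> {directed eb, directed ec, directed ed}" "directed eb \<notin> {directed ec, directed ed}"
    "directed ec \<noteq> directed ed"
    using card_generators by (auto simp: card_insert_if split: if_splits)
  have "(\<Sum>s\<in>generators. f (pos (s w))) = f (pos (flip w)) + (f (pos (directed eb w))
      + (f (pos (directed ec w)) + f (pos (directed ed w))))"
    unfolding generators_def using distinct by simp
  also have "\<dots> = f (step_a (pos w)) + 2 * f (step_v (2 ^ length w) (pos w)) + f (pos w)"
    using assms two(2)[of "length (takeWhile id w)"] two(1)[of "length (takeWhile id w)"]
    by (auto simp: pos_flip pos_directed)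
  finally show ?thesis .
qed

text \<open>If \<open>f\<close> is an eigenfunction on the path, then the Markov operator fails to multiply the test vector by
  \<open>(\<mu> + 1) / 4\<close> only because the generators change the weight.\<close>

lemma test_vector_residual:
  assumes n: "n \<ge> 2" and \<mu>: "\<forall>j<2 ^ n. f (step_a j) + 2 * f (step_v (2 ^ n) j) = \<mu> * f j"
    and R_def: "\<And>h. R h = (\<Sum>s\<in>generators. test_vector n f (s \<circ> h)) / 4 - ((\<mu> + 1) / 4) * test_vector n f h"
  shows "h \<notin> weight_support n \<Longrightarrow> test_vector n f h = 0"
    and "h \<notin> weight_support n \<Longrightarrow> R h = 0"
    and "(\<Sum>h\<in>weight_support n. (R h)\<^sup>2) \<le> energy_bound n * (\<Sum>h\<in>weight_support n. (test_vector n f h)\<^sup>2)"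
proof -
  let ?x = "replicate n True"
  have n1: "n \<ge> 1" using n by simp
  show "test_vector n f h = 0" if "h \<notin> weight_support n" for h
    using that by (simp add: test_vector_def weight_outside)
  have R: "R h = (\<Sum>s\<in>generators. f (pos (s (h ?x))) * (weight n (s \<circ> h) h - weight n h h)) / 4"
    if h: "h \<in> tree_like n" for h
  proof -
    have len: "length (h ?x) = n" using h by (simp add: tree_like_def)
    have "h ?x \<noteq> []" using len n by auto
    then have "(\<Sum>s\<in>generators. f (pos (s (h ?x)))) = (\<mu> + 1) * f (pos (h ?x))"
      using sum_generators[of "h ?x" f] \<mu>[rule_format, of "pos (h ?x)"] pos_less[of "h ?x"] len n
      by (auto simp: algebra_simps)
    moreover have "(\<Sum>s\<in>generators. test_vector n f (s \<circ> h)) = (\<Sum>s\<in>generators. f (pos (s (h ?x))) * weight n (s \<circ> h) h)"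
      using h n1 by (intro sum.cong) (simp_all add: test_vector_def generator_comp_tree_like weight_generator)
    moreover have "(\<Sum>s\<in>generators. f (pos (s (h ?x))) * (weight n (s \<circ> h) h - weight n h h))
        = (\<Sum>s\<in>generators. f (pos (s (h ?x))) * weight n (s \<circ> h) h)
          - (\<Sum>s\<in>generators. f (pos (s (h ?x)))) * weight n h h"
      by (simp add: right_diff_distrib sum_subtractf sum_distrib_right)
    moreover have "test_vector n f h = f (pos (h ?x)) * weight n h h" using h by (simp add: test_vector_def)
    ultimately show ?thesis
      unfolding R_def by (simp only:) (simp add: field_simps)
  qed
  show "R h = 0" if "h \<notin> weight_support n" for h
  proof (cases "h \<in> tree_like n")
    case True
    then show ?thesis using that by (simp add: R weight_outside)
  next
    case False
    then have "test_vector n f (s \<circ> h) = 0" if "s \<in> generators" for s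
      using that n1 by (simp add: test_vector_def generator_comp_tree_like)
    then show ?thesis using False by (simp add: R_def test_vector_def)
  qed
  have fin: "card generators = 4" "finite generators"
    using card_generators by (simp_all add: generators_def)
  have "(\<Sum>h\<in>weight_support n. (R h)\<^sup>2) \<le> (\<Sum>h\<in>weight_support n. \<Sum>s\<in>generators.
      ((f (pos (s (h ?x))))\<^sup>2 * (weight n (s \<circ> h) h - weight n h h)\<^sup>2) / 4)"
  proof (rule sum_mono)
    fix h assume "h \<in> weight_support n"
    then have h: "h \<in> tree_like n" by (simp add: weight_support_def)
    have "(R h)\<^sup>2 = (\<Sum>s\<in>generators. f (pos (s (h ?x))) * (weight n (s \<circ> h) h - weight n h h))\<^sup>2 / 16"
      by (simp add: R[OF h] power_divide)
    also have "\<dots> \<le> ((\<Sum>s\<in>generators. (f (pos (s (h ?x))) * (weight n (s \<circ> h) h - weight n h h))\<^sup>2) * card generators) / 16"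
      by (intro divide_right_mono sum_squared_le_sum_of_squares fin) simp
    also have "\<dots> = (\<Sum>s\<in>generators. ((f (pos (s (h ?x))))\<^sup>2 * (weight n (s \<circ> h) h - weight n h h)\<^sup>2) / 4)"
      by (simp add: fin power_mult_distrib sum_divide_distrib[symmetric])
    finally show "(R h)\<^sup>2 \<le> \<dots>" .
  qed
  also have "\<dots> = (\<Sum>s\<in>generators. (\<Sum>h\<in>weight_support n.
      (f (pos (s (h ?x))))\<^sup>2 * (weight n (s \<circ> h) h - weight n h h)\<^sup>2) / 4)"
    by (subst sum.swap) (simp add: sum_divide_distrib)
  also have "\<dots> \<le> (\<Sum>s\<in>generators. (energy_bound n * (\<Sum>h\<in>weight_support n. (f (pos (h ?x)) * weight n h h)\<^sup>2)) / 4)"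
    by (intro sum_mono divide_right_mono weight_energy[where F = "\<lambda>w. f (pos w)"] n) simp_all
  also have "\<dots> = energy_bound n * (\<Sum>h\<in>weight_support n. (f (pos (h ?x)) * weight n h h)\<^sup>2)"
    by (simp add: fin)
  also have "(\<Sum>h\<in>weight_support n. (f (pos (h ?x)) * weight n h h)\<^sup>2) = (\<Sum>h\<in>weight_support n. (test_vector n f h)\<^sup>2)"
    by (intro sum.cong) (auto simp: test_vector_def weight_support_def)
  finally show "(\<Sum>h\<in>weight_support n. (R h)\<^sup>2) \<le> energy_bound n * (\<Sum>h\<in>weight_support n. (test_vector n f h)\<^sup>2)" .
qed

lemma test_vector_nonzero:
  assumes n: "n \<ge> 1" and f: "f 0 \<noteq> 0"
  shows "0 < (\<Sum>h\<in>weight_support n. (test_vector n f h)\<^sup>2)"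
proof (rule sum_pos2[OF finite_weight_support])
  have "pos (replicate k True) = 0" for k by (induction k) simp_all
  moreover have "id \<in> tree_like n" by (simp add: tree_like_def)
  ultimately have "test_vector n f id \<noteq> 0" using weight_id_pos[OF n] f by (simp add: test_vector_def)
  then show "0 < (test_vector n f id)\<^sup>2" by simp
  show "id \<in> weight_support n"
    using weight_outside[OF \<open>id \<in> tree_like n\<close>, of id] weight_id_pos[OF n] by force
qed simp

end

text \<open>The wave numbers \<open>k \<pi> / 2\<^sup>n\<close> are dense, so the eigenvalues of the paths are dense.\<close>

lemma exists_dyadic_angle:
  fixes K :: real
  assumes m0: "1 \<le> \<bar>m0\<bar>" "\<bar>m0\<bar> \<le> (3::real)" and e: "e > 0"
  shows "\<exists>n \<theta> \<mu>. \<exists>k::int. n \<ge> 2 \<and> 2 ^ n > K \<and> 2 ^ n * \<theta> = of_int k * pi \<and> 0 < \<theta> \<and> \<theta> < pi / 2 \<and>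
    \<mu>\<^sup>2 = 1 + 8 * (cos \<theta>)\<^sup>2 \<and> \<bar>\<mu> - m0\<bar> < e"
proof -
  define \<phi> where "\<phi> \<theta> = sqrt (1 + 8 * (cos \<theta>)\<^sup>2)" for \<theta> :: real
  have cont: "isCont \<phi> x" for x unfolding \<phi>_def by (intro continuous_intros)
  have "\<exists>x. 0 \<le> x \<and> x \<le> pi / 2 \<and> \<phi> x = \<bar>m0\<bar>"
  proof (rule IVT2)
    show "\<phi> (pi / 2) \<le> \<bar>m0\<bar>" "\<bar>m0\<bar> \<le> \<phi> 0" using m0 by (simp_all add: \<phi>_def)
  qed (use cont in auto)
  then obtain t where t: "0 \<le> t" "t \<le> pi / 2" "\<phi> t = \<bar>m0\<bar>" by blast
  obtain d where d: "d > 0" "\<And>x. \<bar>x - t\<bar> < d \<Longrightarrow> \<bar>\<phi> x - \<phi> t\<bar> < e"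
    using cont[of t] e unfolding continuous_at_eps_delta dist_real_def by blast
  define l where "l = max 0 (t - d)"
  define u where "u = min (pi / 2) (t + d)"
  have lu: "l < u" using t(1,2) d(1) pi_gt_zero unfolding l_def u_def max_def min_def by (simp; linarith)
  have "\<exists>n. max K (pi / (u - l)) < 2 ^ n" by (rule real_arch_pow) simp
  then obtain n0 where n0: "max K (pi / (u - l)) < 2 ^ n0" ..
  define n where "n = max 2 n0"
  have "(2::real) ^ n0 \<le> 2 ^ n" by (intro power_increasing) (auto simp: n_def)
  with n0 have n: "K < 2 ^ n" "pi / (u - l) < 2 ^ n" by linarith+
  have n2: "n \<ge> 2" by (simp add: n_def)
  define k where "k = \<lfloor>l * 2 ^ n / pi\<rfloor> + 1"
  define \<theta> where "\<theta> = of_int k * pi / 2 ^ n"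
  have "l * 2 ^ n / pi < of_int k" "of_int k \<le> l * 2 ^ n / pi + 1" 
    unfolding k_def using floor_correct[of "l * 2 ^ n / pi"] by simp_all
  then have "l * 2 ^ n < of_int k * pi" "of_int k * pi \<le> l * 2 ^ n + pi"
    using pi_gt_zero by (simp_all add: field_simps)
  then have "l < \<theta>" "\<theta> \<le> l + pi / 2 ^ n" by (simp_all add: \<theta>_def field_simps)
  moreover have "pi / 2 ^ n < u - l" using n(2) lu by (simp add: field_simps)
  ultimately have \<theta>: "l < \<theta>" "\<theta> < u" by linarith+
  have range: "0 < \<theta>" "\<theta> < pi / 2" "\<bar>\<theta> - t\<bar> < d" using \<theta> unfolding l_def u_def by auto
  define \<mu> where "\<mu> = (if m0 < 0 then - \<phi> \<theta> else \<phi> \<theta>)"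
  have "\<mu>\<^sup>2 = 1 + 8 * (cos \<theta>)\<^sup>2" by (simp add: \<mu>_def \<phi>_def)
  moreover have "\<bar>\<mu> - m0\<bar> < e" using d(2)[OF range(3)] t(3) by (auto simp: \<mu>_def abs_if split: if_splits)
  moreover have "2 ^ n * \<theta> = of_int k * pi" by (simp add: \<theta>_def)
  ultimately show ?thesis using n n2 range
    by (intro exI[of _ n] exI[of _ \<theta>] exI[of _ \<mu>] exI[of _ k] conjI)
qed

lemma energy_bound_le:
  assumes "n \<ge> 1"
  shows "energy_bound n \<le> 8 / 2 ^ n"
proof -
  define N :: real where "N = 2 ^ n"
  have N: "N \<ge> 2" using power_increasing[OF assms, of "2::real"] by (simp add: N_def)
  have "(pi / 3)\<^sup>2 \<le> (4 / 3)\<^sup>2" using pi_less_4 by (intro power_mono) auto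
  then have pi: "(pi / 3)\<^sup>2 \<le> 2" by (simp add: power2_eq_square)
  have "(N / 2)\<^sup>2 \<le> (N - 1)\<^sup>2" using N by (intro power_mono) auto
  then have "N * (pi / 3 / (N - 1))\<^sup>2 \<le> N * (2 / (N / 2)\<^sup>2)"
    unfolding power_divide[of "pi / 3"] using N pi by (intro mult_left_mono frac_le) auto
  also have "\<dots> = 8 / N" using N by (simp add: power2_eq_square)
  finally show ?thesis by (simp add: energy_bound_def N_def)
qed

text \<open>The eigenvalue of the test vector is only close to the target \<open>l\<close>, as the angle has to be a multiple of
  \<open>\<pi> / 2\<^sup>n\<close>; one half of the error \<open>e\<close> is spent on this and the other half on the weight.\<close>

lemma path_spectrum_in_group_spectrum:
  fixes G :: "(vertex \<Rightarrow> vertex, 'm) monoid_scheme" (structure)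
  assumes "two_of_three eb ec ed" "involution_and_klein_group G flip (directed eb) (directed ec) (directed ed)"
    and mult: "\<And>x y. x \<otimes> y = x \<circ> y" and one: "\<one> = id"
    and l: "l \<in> {- 1/2 .. 0} \<union> {1/2 .. 1}"
  shows "complex_of_real l \<in> group_spectrum G {flip, directed eb, directed ec, directed ed}"
proof -
  interpret two_of_three eb ec ed by fact
  interpret involution_and_klein_group G flip "directed eb" "directed ec" "directed ed" by fact
  let ?M = "markov G {flip, directed eb, directed ec, directed ed}"
  show ?thesis
    unfolding group_spectrum_def
  proof (rule approximate_eigenvalue_in_spectrum[OF bounded_operator_markov])
    fix e :: real assume e: "e > 0"
    have m0: "1 \<le> \<bar>4 * l - 1\<bar>" "\<bar>4 * l - 1\<bar> \<le> 3" using l by (auto simp: abs_if)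
    \<comment> \<open>An error of \<open>2 e\<close> in \<open>\<mu> = 4 l - 1\<close> is one of \<open>e / 2\<close> in \<open>l\<close>; and \<open>32 / e\<^sup>2 < 2\<^sup>n\<close> makes the bound
      \<open>8 / 2\<^sup>n\<close> on the energy smaller than \<open>(e / 2)\<^sup>2\<close>.\<close>
    obtain n \<theta> \<mu> and k :: int where n: "n \<ge> 2" "32 / e\<^sup>2 < 2 ^ n"
      and \<theta>: "2 ^ n * \<theta> = of_int k * pi" "0 < \<theta>" "\<theta> < pi / 2"
      and \<mu>: "\<mu>\<^sup>2 = 1 + 8 * (cos \<theta>)\<^sup>2" "\<bar>\<mu> - (4 * l - 1)\<bar> < 2 * e"
      using exists_dyadic_angle[OF m0, of "2 * e" "32 / e\<^sup>2"] e by auto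
    define f where "f = path_eigenfunction (2 ^ n) \<theta> \<mu>"
    define R where "R h = (\<Sum>s\<in>generators. test_vector n f (s \<circ> h)) / 4 - ((\<mu> + 1) / 4) * test_vector n f h" for h
    have eig: "\<forall>j<2 ^ n. f (step_a j) + 2 * f (step_v (2 ^ n) j) = \<mu> * f j"
      unfolding f_def using n \<theta>(1) by (intro allI impI path_eigenfunction[OF _ _ _ \<mu>(1)]) auto
    note res = test_vector_residual[OF n(1) eig R_def]
    have "f 0 \<noteq> 0" unfolding f_def by (rule path_eigenfunction_nonzero[OF \<mu>(1) \<theta>(2,3)])
    then have pos: "0 < (\<Sum>h\<in>weight_support n. (test_vector n f h)\<^sup>2)" using n(1) by (intro test_vector_nonzero) auto
    have surj: "surj h" if "h \<in> weight_support n" for h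
      using that by (simp add: weight_support_def tree_like_def)
    have "\<exists>v\<in>ell2 (carrier G). v \<noteq> (\<lambda>_. 0) \<and>
      ell2_norm (carrier G) (\<lambda>g. ?M v g - of_real ((\<mu> + 1) / 4) * v g) \<le> sqrt (energy_bound n) * ell2_norm (carrier G) v"
    proof (rule approximate_eigenvector_on_orbit[where D = "weight_support n" and \<Psi> = "test_vector n f" and R = R,
          OF assms(2) mult one finite_weight_support _ _ _ _ res(3) pos])
      show "R h = (\<Sum>s\<in>{flip, directed eb, directed ec, directed ed}. test_vector n f (s \<circ> h)) / 4
          - ((\<mu> + 1) / 4) * test_vector n f h" for h
        by (simp only: R_def generators_def)
    qed (simp_all add: surj res(1,2))
    then obtain v where v: "v \<in> ell2 (carrier G)" "v \<noteq> (\<lambda>_. 0)"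
      "ell2_norm (carrier G) (\<lambda>g. ?M v g - of_real ((\<mu> + 1) / 4) * v g) \<le> sqrt (energy_bound n) * ell2_norm (carrier G) v"
      by (elim bexE conjE)
    have "energy_bound n \<le> 8 / 2 ^ n" using n(1) by (intro energy_bound_le) simp
    also have "\<dots> \<le> (e / 2)\<^sup>2" using n(2) e by (simp add: field_simps power2_eq_square)
    finally have E: "sqrt (energy_bound n) \<le> e / 2" using e by (intro real_le_lsqrt) auto
    let ?r = "\<lambda>g. ?M v g - of_real ((\<mu> + 1) / 4) * v g"
    have r: "?r \<in> ell2 (carrier G)"
      using ell2_add(1)[OF bounded_operator_ell2[OF bounded_operator_markov v(1)] ell2_scale(1)[OF v(1), of "- of_real ((\<mu> + 1) / 4)"]]
      by (simp only: mult_minus_left add_uminus_conv_diff)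
    have "(\<lambda>g. ?M v g - of_real l * v g) = (\<lambda>g. ?r g + of_real ((\<mu> + 1) / 4 - l) * v g)"
      by (simp add: algebra_simps)
    then have "ell2_norm (carrier G) (\<lambda>g. ?M v g - of_real l * v g)
        \<le> ell2_norm (carrier G) ?r + \<bar>(\<mu> + 1) / 4 - l\<bar> * ell2_norm (carrier G) v"
      using ell2_add(2)[OF r ell2_scale(1)[OF v(1), of "of_real ((\<mu> + 1) / 4 - l)"]]
        ell2_scale(2)[OF v(1), of "of_real ((\<mu> + 1) / 4 - l)"] by (simp only: norm_of_real)
    also have "\<dots> \<le> e / 2 * ell2_norm (carrier G) v + e / 2 * ell2_norm (carrier G) v"
    proof (intro add_mono mult_right_mono ell2_norm_nonneg)
      show "ell2_norm (carrier G) ?r \<le> e / 2 * ell2_norm (carrier G) v"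
        using v(3) mult_right_mono[OF E ell2_norm_nonneg[of "carrier G" v]] by linarith
      have "(\<mu> + 1) / 4 - l = (\<mu> - (4 * l - 1)) / 4" by (simp add: field_simps)
      then have "\<bar>(\<mu> + 1) / 4 - l\<bar> = \<bar>\<mu> - (4 * l - 1)\<bar> / 4" by (simp only: abs_divide abs_numeral)
      also have "\<dots> \<le> e / 2" using \<mu>(2) by simp
      finally show "\<bar>(\<mu> + 1) / 4 - l\<bar> \<le> e / 2" .
    qed
    finally have "ell2_norm (carrier G) (\<lambda>g. ?M v g - of_real l * v g) \<le> e * ell2_norm (carrier G) v" by simp
    then show "\<exists>f\<in>ell2 (carrier G). f \<noteq> (\<lambda>_. 0) \<and>
        ell2_norm (carrier G) (\<lambda>g. ?M f g - complex_of_real l * f g) \<le> e * ell2_norm (carrier G) f"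
      using v(1,2) by (intro bexI[of _ v] conjI)
  qed
qed

section \<open>The spectrum of \<open>G\<^sub>\<omega>\<close>\<close>

text \<open>The bit of \<open>b\<close>, \<open>c\<close> or \<open>d\<close> at an index is false for exactly one of the symbols \<open>0, 1, 2\<close>.  Of two symbols
  that occur infinitely often, at least one is different from it.\<close>

lemma two_of_three_Omega2:
  assumes "\<omega> \<in> Omega2"
  shows "two_of_three (\<lambda>i. fst (column (\<omega> (Suc i))) = PiSym) (\<lambda>i. fst (snd (column (\<omega> (Suc i)))) = PiSym)
    (\<lambda>i. snd (snd (column (\<omega> (Suc i)))) = PiSym)"
proof -
  have ex: "\<exists>i\<ge>n. \<omega> (Suc i) \<in> {0, 1, 2} - {j}" for j n
  proof -
    let ?I = "{k \<in> {0, 1, 2::nat}. infinite {n. n \<ge> 1 \<and> \<omega> n = k}}"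
    have "card ?I \<ge> 2" using assms by (simp add: Omega2_def)
    then have "\<not> ?I \<subseteq> {j}" using card_mono[of "{j}" ?I] by auto
    then obtain k where k: "k \<in> {0, 1, 2}" "k \<noteq> j" "infinite {n. n \<ge> 1 \<and> \<omega> n = k}" by blast
    then obtain m where "m \<ge> Suc n" "\<omega> m = k"
      unfolding infinite_nat_iff_unbounded_le by blast
    with k show ?thesis by (intro exI[of _ "m - 1"]) auto
  qed
  show ?thesis
  proof
    fix n
    obtain i where "i \<ge> n" "\<omega> (Suc i) \<in> {0, 1, 2} - {2}" using ex by blast
    then show "\<exists>i\<ge>n. fst (column (\<omega> (Suc i))) = PiSym"
      by (intro exI[of _ i]) (auto simp: column_def)
    obtain i where "i \<ge> n" "\<omega> (Suc i) \<in> {0, 1, 2} - {1}" using ex by blast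
    then show "\<exists>i\<ge>n. fst (snd (column (\<omega> (Suc i)))) = PiSym"
      by (intro exI[of _ i]) (auto simp: column_def)
    obtain i where "i \<ge> n" "\<omega> (Suc i) \<in> {0, 1, 2} - {0}" using ex by blast
    then show "\<exists>i\<ge>n. snd (snd (column (\<omega> (Suc i)))) = PiSym"
      by (intro exI[of _ i]) (auto simp: column_def)
  qed (auto simp: column_def)
qed

lemma gens_directed:
  "gens \<omega> = {flip, directed (\<lambda>i. fst (column (\<omega> (Suc i))) = PiSym),
    directed (\<lambda>i. fst (snd (column (\<omega> (Suc i)))) = PiSym),
    directed (\<lambda>i. snd (snd (column (\<omega> (Suc i)))) = PiSym)}"
  by (simp add: gens_def gen_a_def gen_b_def gen_c_def gen_d_def sigma_aut_0 sigma_prod_directed)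

lemma involution_and_klein_group_G_omega:
  assumes gens: "gens \<omega> = {flip, directed eb, directed ec, directed ed}" and "two_of_three eb ec ed"
  shows "involution_and_klein_group (G_omega \<omega>) flip (directed eb) (directed ec) (directed ed)"
proof -
  interpret two_of_three eb ec ed by fact
  interpret T: group tree_aut_group by (rule group_tree_aut_group)
  have mult: "x \<otimes>\<^bsub>G_omega \<omega>\<^esub> y = x \<circ> y" for x y
    by (simp add: G_omega_def subgroup_generated_def tree_aut_group_def)
  have one: "\<one>\<^bsub>G_omega \<omega>\<^esub> = id"
    by (simp add: G_omega_def subgroup_generated_def tree_aut_group_def)
  have carrier: "s \<in> carrier (G_omega \<omega>)" if "s \<in> gens \<omega>" for s
    using that gens_subset_carrier[of \<omega>]
    by (auto simp: G_omega_def carrier_subgroup_generated intro: generate.incl)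
  have xor: "(eb i = (\<not> ec i)) = ed i" "(ec i = (\<not> eb i)) = ed i" "(eb i = (\<not> ed i)) = ec i"
    "(ed i = (\<not> eb i)) = ec i" "(ec i = (\<not> ed i)) = eb i" "(ed i = (\<not> ec i)) = eb i" for i
    using two by blast+
  have "group (G_omega \<omega>)" unfolding G_omega_def by (rule T.group_subgroup_generated)
  then show ?thesis
    by (intro involution_and_klein_group.intro involution_and_klein_group_axioms.intro)
      (simp_all add: mult one carrier gens card_generators fun_eq_iff directed_directed directed_False xor)
qed

theorem theorem1p1:
  fixes \<omega> :: "nat \<Rightarrow> nat"
  assumes "\<omega> \<in> Omega2"
  shows "group_spectrum (G_omega \<omega>) (gens \<omega>) = complex_of_real ` ({- 1/2 .. 0} \<union> {1/2 .. 1})"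
proof -
  let ?eb = "\<lambda>i. fst (column (\<omega> (Suc i))) = PiSym"
  let ?ec = "\<lambda>i. fst (snd (column (\<omega> (Suc i)))) = PiSym"
  let ?ed = "\<lambda>i. snd (snd (column (\<omega> (Suc i)))) = PiSym"
  note seqs = two_of_three_Omega2[OF assms]
  note group = involution_and_klein_group_G_omega[OF gens_directed seqs]
  have "complex_of_real l \<in> group_spectrum (G_omega \<omega>) (gens \<omega>)" if "l \<in> {- 1/2 .. 0} \<union> {1/2 .. 1}" for l
    unfolding gens_directed
    by (rule path_spectrum_in_group_spectrum[OF seqs group _ _ that])
      (simp_all add: G_omega_def subgroup_generated_def tree_aut_group_def)
  moreover have "group_spectrum (G_omega \<omega>) (gens \<omega>) \<subseteq> complex_of_real ` ({- 1/2 .. 0} \<union> {1/2 .. 1})"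
    unfolding gens_directed by (rule involution_and_klein_group.group_spectrum_subset[OF group])
  ultimately show ?thesis by blast
qed

end
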